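(* Let $A$ be a $\sigma$-unital C*-algebra and let $\alpha\colon G\to \mathrm{Aut}(A)$ be an action of a finite group $G$ on $A$. If $\alpha$ has the central sequence Rokhlin property, then $\alpha$ has the Rokhlin property. Moreover, if $A$ is separable, then $\alpha$ has the central sequence Rokhlin property if and only if it has the Rokhlin property.
   Context: Rokhlin property: for any $\epsilon>0$ and any finite subset $F\subset A$ there exist mutually orthogonal positive contractions $(r_g)_{g\in G}\subset A$ such that (i) $\|\alpha_g(r_h)-r_{gh}\|<\epsilon$ for all $g,h\in G$; (ii) $\|r_ga-ar_g\|<\epsilon$ for all $a\in F$ and $g\in G$; (iii) $\|(\sum_{g\in G} r_g)a-a\|<\epsilon$ for all $a\in F$. Central sequence Rokhlin property (Rokhlin property in the sense of Nawata): Let $A^\infty=\ell_\infty(\mathbb N,A)/c_0(\mathbb N,A)$, with $A$ embedded as constant sequences; let $\mathrm{Ann}(A,A^\infty)=\{x\in A^\infty\cap A': xa=0 \text{ for all } a\in A\}$, a closed two-sided ideal of $A^\infty\cap A'$, and let $\mathrm F(A)=(A^\infty\cap A')/\mathrm{Ann}(A,A^\infty)$, which is unital because $A$ is $\sigma$-unital. The action $\alpha$ induces an action on $\mathrm F(A)$, again denoted $\alpha$. Then $\alpha$ has the central sequence Rokhlin property if there exist projections $(p_g)_{g\in G}\subset \mathrm F(A)$ with $\sum_{g\in G}p_g=1_{\mathrm F(A)}$ and $\alpha_g(p_h)=p_{gh}$ for all $g,h\in G$. *)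

theory Defs
  imports "HOL-Analysis.Analysis" "HOL-Algebra.Group"
begin

section \<open>C*-algebras\<close>

class star_ring = ring +
  fixes star :: "'a \<Rightarrow> 'a"
  assumes star_star [simp]: "star (star x) = x"
    and star_add: "star (x + y) = star x + star y"
    and star_mult: "star (x * y) = star y * star x"

text \<open>Class \<^class>\<open>ring\<close> does not require a unit. The real scalar multiplication of
  \<^class>\<open>real_normed_algebra\<close> is the restriction of the complex one.\<close>

class cstar_algebra = banach + real_normed_algebra + star_ring +
  fixes scaleC :: "complex \<Rightarrow> 'a \<Rightarrow> 'a"
  assumes scaleC_of_real: "scaleC (complex_of_real r) x = r *\<^sub>R x"
    and scaleC_add_right: "scaleC c (x + y) = scaleC c x + scaleC c y"
    and scaleC_add_left: "scaleC (c + d) x = scaleC c x + scaleC d x"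
    and scaleC_scaleC: "scaleC c (scaleC d x) = scaleC (c * d) x"
    and mult_scaleC_left: "scaleC c x * y = scaleC c (x * y)"
    and mult_scaleC_right: "x * scaleC c y = scaleC c (x * y)"
    and norm_scaleC: "norm (scaleC c x) = cmod c * norm x"
    and star_scaleC: "star (scaleC c x) = scaleC (cnj c) (star x)"
    and norm_star_mult_self: "norm (star x * x) = (norm x)\<^sup>2"

definition positive :: "'a::cstar_algebra \<Rightarrow> bool"
  where "positive x \<longleftrightarrow> (\<exists>y. x = star y * y)"

definition projection :: "'a::star_ring \<Rightarrow> bool"
  where "projection p \<longleftrightarrow> star p = p \<and> p * p = p"

definition sigma_unital :: "'a::cstar_algebra itself \<Rightarrow> bool"
  where "sigma_unital _ \<longleftrightarrow>
    (\<exists>e :: nat \<Rightarrow> 'a. (\<forall>n. positive (e n) \<and> norm (e n) \<le> 1) \<and>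
       (\<forall>a. (\<lambda>n. e n * a) \<longlonglongrightarrow> a \<and> (\<lambda>n. a * e n) \<longlonglongrightarrow> a))"

definition star_hom :: "('a::cstar_algebra \<Rightarrow> 'b::cstar_algebra) \<Rightarrow> bool"
  where "star_hom \<phi> \<longleftrightarrow>
    (\<forall>x y. \<phi> (x + y) = \<phi> x + \<phi> y) \<and> (\<forall>c x. \<phi> (scaleC c x) = scaleC c (\<phi> x)) \<and>
    (\<forall>x y. \<phi> (x * y) = \<phi> x * \<phi> y) \<and> (\<forall>x. \<phi> (star x) = star (\<phi> x))"

definition Aut :: "('a::cstar_algebra \<Rightarrow> 'a) monoid"
  where "Aut = \<lparr>carrier = {\<phi>. star_hom \<phi> \<and> bij \<phi>}, mult = (\<circ>), one = id\<rparr>"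

lemma group_Aut: "group (Aut :: ('a::cstar_algebra \<Rightarrow> 'a) monoid)"
proof (rule groupI)
  fix \<phi> \<psi> \<chi> :: "'a \<Rightarrow> 'a"
  assume \<phi>: "\<phi> \<in> carrier Aut"
  have bij: "bij \<phi>" and hom: "star_hom \<phi>" using \<phi> by (simp_all add: Aut_def)
  have eq: "inv_into UNIV \<phi> y = x \<longleftrightarrow> y = \<phi> x" for x y
    using bij_inv_eq_iff[OF bij] by metis
  have f: "\<phi> (inv_into UNIV \<phi> x) = x" for x using eq by metis
  have "star_hom (inv_into UNIV \<phi>)"
    using hom by (simp add: star_hom_def eq f)
  then have "inv_into UNIV \<phi> \<in> carrier Aut" using \<phi> by (simp add: Aut_def bij_imp_bij_inv)
  moreover have "inv_into UNIV \<phi> \<otimes>\<^bsub>Aut\<^esub> \<phi> = \<one>\<^bsub>Aut\<^esub>"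
    using \<phi> by (simp add: Aut_def bij_is_inj)
  ultimately show "\<exists>\<psi>\<in>carrier Aut. \<psi> \<otimes>\<^bsub>Aut\<^esub> \<phi> = \<one>\<^bsub>Aut\<^esub>" by blast
qed (auto simp: Aut_def star_hom_def bij_comp o_assoc)

lemma star_0 [simp]: "star (0::'a::star_ring) = 0"
  using star_add[of "0::'a" 0] by simp

lemma star_minus: "star (- x) = - star (x::'a::star_ring)"
  by (metis add.right_inverse eq_neg_iff_add_eq_0 star_0 star_add add.commute)

lemma star_diff: "star (x - y) = star x - star (y::'a::star_ring)"
  using star_add[of x "- y"] by (simp add: star_minus)

lemma norm_star [simp]: "norm (star x) = norm (x::'a::cstar_algebra)"
proof -
  have le: "norm y \<le> norm (star y)" for y :: 'a
  proof (cases "y = 0")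
    case False
    have "norm y * norm y \<le> norm (star y) * norm y"
      using norm_mult_ineq[of "star y" y] by (simp add: norm_star_mult_self power2_eq_square)
    then show ?thesis using False by simp
  qed simp
  show ?thesis using le[of x] le[of "star x"] by simp
qed

lemma continuous_on_star: "continuous_on S (star :: 'a::cstar_algebra \<Rightarrow> 'a)"
proof (rule lipschitz_on_continuous_on)
  show "1-lipschitz_on S (star :: 'a \<Rightarrow> 'a)"
    by (rule lipschitz_onI) (simp_all add: dist_norm flip: star_diff)
qed

lemma star_scaleR: "star (r *\<^sub>R x) = r *\<^sub>R star (x::'a::cstar_algebra)"
  by (metis complex_cnj_complex_of_real scaleC_of_real star_scaleC)

text \<open>Homomorphisms of C*-algebras are contractive. For self-adjoint \<^term>\<open>a\<close> of norm less
  than \<^term>\<open>1\<close>, a fixed point \<^term>\<open>s\<close> of \<^term>\<open>\<lambda>s. (a\<^sup>2 + s\<^sup>2) / 2\<close> makes \<open>a + i(1 - s)\<close> a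
  unitary multiplier.\<close>

lemma quadratic_fixed_point:
  fixes a :: "'a::cstar_algebra"
  assumes "star a = a" "norm a < 1"
  obtains s where "star s = s" "s * a = a * s" "s + s = a * a + s * s"
proof -
  define S where "S = {s::'a. star s = s \<and> s * a = a * s \<and> norm s \<le> norm a}"
  define f where "f s = (1/2) *\<^sub>R (a * a + s * s)" for s :: 'a
  have "closed S"
    unfolding S_def
    by (intro closed_Collect_conj closed_Collect_eq closed_Collect_le continuous_on_star
        continuous_intros)
  then have "complete S" by (simp add: complete_eq_closed)
  moreover have "S \<noteq> {}" by (auto simp: S_def intro!: exI[of _ 0])
  moreover have "f ` S \<subseteq> S"
  proof safe
    fix s assume s: "s \<in> S"
    have "norm (a * a + s * s) \<le> norm a * norm a + norm s * norm s"
      by (intro order_trans[OF norm_triangle_ineq] add_mono norm_mult_ineq)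
    also have "\<dots> \<le> norm a * 1 + norm a * 1"
      using s assms(2) by (intro add_mono mult_mono) (auto simp: S_def)
    finally have "norm (f s) \<le> norm a" by (simp add: f_def)
    moreover have "s * s * a = a * (s * s)" using s unfolding S_def mem_Collect_eq by (metis mult.assoc)
    ultimately show "f s \<in> S"
      using s assms(1)
      by (simp add: S_def f_def star_scaleR star_add star_mult distrib_left distrib_right mult.assoc)
  qed
  moreover have "dist (f s) (f t) \<le> norm a * dist s t" if "s \<in> S" "t \<in> S" for s t
  proof -
    have "f s - f t = (1/2) *\<^sub>R (s * (s - t) + (s - t) * t)"
      by (simp add: f_def algebra_simps)
    moreover have "norm (s * (s - t) + (s - t) * t) \<le> norm s * norm (s - t) + norm (s - t) * norm t"
      by (intro order_trans[OF norm_triangle_ineq] add_mono norm_mult_ineq)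
    moreover have "norm s * norm (s - t) \<le> norm a * norm (s - t)" "norm (s - t) * norm t \<le> norm (s - t) * norm a"
      using that by (auto simp: S_def intro!: mult_right_mono mult_left_mono)
    ultimately show ?thesis by (simp add: dist_norm mult.commute)
  qed
  ultimately have "\<exists>!s\<in>S. f s = s"
    using assms(2) by (intro Banach_fix[of S "norm a"]) auto
  then obtain s where s: "s \<in> S" "f s = s" by auto
  have "s + s = a * a + s * s"
  proof -
    have "2 *\<^sub>R s = 2 *\<^sub>R f s" using s by simp
    then show ?thesis by (simp add: f_def scaleR_2)
  qed
  moreover have "star s = s" "s * a = a * s" using s by (simp_all add: S_def)
  ultimately show thesis using that by blast
qed

lemma norm_le_one_of_quadratic:
  fixes b t :: "'a::cstar_algebra"
  assumes b: "star b = b" and t: "star t = t" "t * b = b * t" "t + t = b * b + t * t"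
  shows "norm b \<le> 1"
proof -
  define d where "d = b - t * b"
  have tb: "t * (b * x) = b * (t * x)" for x using t(2) by (metis mult.assoc)
  have cross: "star (b * b) * d = star d * (b * b)"
    using b t(1,2) tb by (simp add: d_def star_diff star_mult left_diff_distrib right_diff_distrib mult.assoc)
  have "star (b * b) * (b * b) + star d * d = b * (b * b + t * t - t - t) * b + b * b"
    using b t(1) by (simp add: d_def star_diff star_mult algebra_simps)
  moreover have "b * b + t * t - t - t = 0" by (simp flip: t(3))
  ultimately have sq: "star (b * b) * (b * b) + star d * d = star b * b"
    using b by simp
  have w: "norm (b * b + scaleC c d) = norm b" if c: "c = \<i> \<or> c = - \<i>" for c
  proof -
    have "star (b * b + scaleC c d) * (b * b + scaleC c d) =
        (star (b * b) * (b * b) + scaleC (cnj c * c) (star d * d)) +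
        (scaleC c (star (b * b) * d) + scaleC (cnj c) (star d * (b * b)))"
      by (simp add: star_add star_scaleC distrib_left distrib_right mult_scaleC_left
          mult_scaleC_right scaleC_scaleC scaleC_add_right mult.commute)
    also have "\<dots> = star b * b"
    proof -
      have "scaleC (cnj c * c) (star d * d) = star d * d"
        using c scaleC_of_real[of 1 "star d * d"] by auto
      moreover have "scaleC c (star (b * b) * d) + scaleC (cnj c) (star d * (b * b)) = 0"
        using c scaleC_of_real[of 0 "star d * (b * b)"]
        by (auto simp: cross simp flip: scaleC_add_left)
      ultimately show ?thesis using sq by simp
    qed
    finally have "(norm (b * b + scaleC c d))\<^sup>2 = (norm b)\<^sup>2"
      by (metis norm_star_mult_self)
    then show ?thesis by (simp add: power2_eq_iff_nonneg)
  qed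
  have "(b * b + scaleC \<i> d) + (b * b + scaleC (- \<i>) d) = 2 *\<^sub>R (b * b)"
  proof -
    have "scaleC \<i> d + scaleC (- \<i>) d = 0"
      using scaleC_of_real[of 0 d] by (simp flip: scaleC_add_left)
    then show ?thesis by (simp add: scaleR_2 algebra_simps)
  qed
  then have "2 * norm (b * b) \<le> norm b + norm b"
    using norm_triangle_ineq[of "b * b + scaleC \<i> d" "b * b + scaleC (- \<i>) d"] w by simp
  then have "norm b * norm b \<le> norm b * 1"
    using norm_star_mult_self[of b] b by (simp add: power2_eq_square)
  then show ?thesis by (cases "b = 0") (auto simp: mult_le_cancel_left)
qed

lemma star_hom_scaleR: "star_hom \<phi> \<Longrightarrow> \<phi> (r *\<^sub>R x) = r *\<^sub>R \<phi> x"
  unfolding star_hom_def scaleC_of_real[symmetric] by blast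

lemma star_hom_0: "star_hom \<phi> \<Longrightarrow> \<phi> 0 = 0"
  using star_hom_scaleR[of \<phi> 0 0] by simp

lemma star_hom_diff: "star_hom \<phi> \<Longrightarrow> \<phi> (x - y) = \<phi> x - \<phi> y"
proof -
  assume "star_hom \<phi>"
  then have "\<phi> (x - y) + \<phi> y = \<phi> (x - y + y)" unfolding star_hom_def by metis
  then show ?thesis by (simp add: eq_diff_eq)
qed

lemma star_hom_norm_le:
  assumes \<phi>: "star_hom \<phi>"
  shows "norm (\<phi> x) \<le> norm x"
proof -
  have hom: "\<phi> (y + z) = \<phi> y + \<phi> z" "\<phi> (y * z) = \<phi> y * \<phi> z" "\<phi> (star y) = star (\<phi> y)" for y z
    using \<phi> by (simp_all add: star_hom_def)
  have one: "norm (\<phi> a) \<le> 1" if a: "star a = a" "norm a < 1" for a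
  proof -
    obtain s where s: "star s = s" "s * a = a * s" "s + s = a * a + s * s"
      by (rule quadratic_fixed_point[OF a])
    then have "star (\<phi> a) = \<phi> a" "star (\<phi> s) = \<phi> s" "\<phi> s * \<phi> a = \<phi> a * \<phi> s"
        "\<phi> s + \<phi> s = \<phi> a * \<phi> a + \<phi> s * \<phi> s"
      by (simp_all only: hom[symmetric] s a)
    then show ?thesis by (rule norm_le_one_of_quadratic)
  qed
  have sa: "norm (\<phi> a) \<le> norm a" if a: "star a = a" for a
  proof (rule dense_ge)
    fix k assume k: "norm a < k"
    then have "0 < k" using norm_ge_zero[of a] by linarith
    with k have "norm (\<phi> ((1/k) *\<^sub>R a)) \<le> 1"
      by (intro one) (simp_all add: star_scaleR a)
    with \<open>0 < k\<close> show "norm (\<phi> a) \<le> k"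
      by (simp add: star_hom_scaleR[OF \<phi>])
  qed
  have "(norm (\<phi> x))\<^sup>2 = norm (\<phi> (star x * x))"
    using \<phi> by (simp add: star_hom_def norm_star_mult_self)
  also have "\<dots> \<le> norm (star x * x)" by (rule sa) (simp add: star_mult)
  finally have "(norm (\<phi> x))\<^sup>2 \<le> (norm x)\<^sup>2" by (simp add: norm_star_mult_self)
  then show ?thesis by (simp add: power2_le_iff_abs_le)
qed

section \<open>The sequence algebra and the central sequence algebra\<close>

text \<open>\<open>\<ell>\<^sub>\<infinity>(\<nat>, A)\<close> is \<^typ>\<open>nat \<Rightarrow>\<^sub>C 'a\<close>, as every function on the discrete space
  \<^typ>\<open>nat\<close> is continuous.\<close>

instantiation bcontfun :: (topological_space, real_normed_algebra) real_normed_algebra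
begin

definition times_bcontfun :: "('a \<Rightarrow>\<^sub>C 'b) \<Rightarrow> ('a \<Rightarrow>\<^sub>C 'b) \<Rightarrow> 'a \<Rightarrow>\<^sub>C 'b"
  where "times_bcontfun f g = Bcontfun (\<lambda>x. f x * g x)"

lemma apply_times_bcontfun [simp]: "apply_bcontfun (f * g) = (\<lambda>x. f x * g x)"
  unfolding times_bcontfun_def
proof (rule Bcontfun_inverse, rule bcontfun_normI)
  show "norm (f x * g x) \<le> norm f * norm g" for x
    by (intro order_trans[OF norm_mult_ineq] mult_mono norm_bounded) auto
qed (intro continuous_intros continuous_on_apply_bcontfun)

instance
proof
  fix f g :: "'a \<Rightarrow>\<^sub>C 'b"
  show "norm (f * g) \<le> norm f * norm g"
    by (rule norm_bound)
      (auto intro!: order_trans[OF norm_mult_ineq] mult_mono norm_bounded)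
qed (auto intro!: bcontfun_eqI simp: algebra_simps)

end

instantiation bcontfun :: (topological_space, cstar_algebra) star_ring
begin

definition star_bcontfun :: "('a \<Rightarrow>\<^sub>C 'b) \<Rightarrow> 'a \<Rightarrow>\<^sub>C 'b"
  where "star_bcontfun f = Bcontfun (\<lambda>x. star (f x))"

lemma apply_star_bcontfun [simp]: "apply_bcontfun (star f) = (\<lambda>x. star (f x))"
  unfolding star_bcontfun_def
proof (rule Bcontfun_inverse, rule bcontfun_normI)
  show "continuous_on UNIV (\<lambda>x. star (f x))"
    by (rule continuous_on_compose2[OF continuous_on_star[of UNIV]]) auto
  show "norm (star (f x)) \<le> norm f" for x by (simp add: norm_bounded)
qed

instance
  by standard (auto intro!: bcontfun_eqI simp: star_add star_mult)

end

definition c0 :: "(nat \<Rightarrow>\<^sub>C 'a::cstar_algebra) set"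
  where "c0 = {f. apply_bcontfun f \<longlonglongrightarrow> 0}"

lemma c0_closed:
  "0 \<in> c0" "f \<in> c0 \<Longrightarrow> g \<in> c0 \<Longrightarrow> f + g \<in> c0" "f \<in> c0 \<Longrightarrow> - f \<in> c0"
  "f \<in> c0 \<Longrightarrow> f * h \<in> c0" "f \<in> c0 \<Longrightarrow> h * f \<in> c0" "f \<in> c0 \<Longrightarrow> star f \<in> c0"
proof -
  have bdd: "eventually (\<lambda>n. norm (h n) \<le> norm h) sequentially" by (simp add: norm_bounded)
  show "f \<in> c0 \<Longrightarrow> f * h \<in> c0"
  proof -
    assume "f \<in> c0"
    then have "(\<lambda>n. norm (f n) * norm h) \<longlonglongrightarrow> 0"
      unfolding c0_def by (auto intro!: tendsto_mult_left_zero tendsto_norm_zero)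
    then show ?thesis
      unfolding c0_def
      by (auto intro!: Lim_null_comparison[where g = "\<lambda>n. norm (f n) * norm h"] always_eventually
          order_trans[OF norm_mult_ineq] mult_left_mono norm_bounded)
  qed
  show "f \<in> c0 \<Longrightarrow> h * f \<in> c0"
  proof -
    assume "f \<in> c0"
    then have "(\<lambda>n. norm h * norm (f n)) \<longlonglongrightarrow> 0"
      unfolding c0_def by (auto intro!: tendsto_mult_right_zero tendsto_norm_zero)
    then show ?thesis
      unfolding c0_def
      by (auto intro!: Lim_null_comparison[where g = "\<lambda>n. norm h * norm (f n)"] always_eventually
          order_trans[OF norm_mult_ineq] mult_right_mono norm_bounded)
  qed
  show "f \<in> c0 \<Longrightarrow> star f \<in> c0"
    unfolding c0_def using tendsto_norm_zero_iff[of "\<lambda>n. star (f n)"]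
      tendsto_norm_zero_iff[of "apply_bcontfun f"] by simp
qed (auto simp: c0_def intro: tendsto_add_zero tendsto_minus_cancel_left[THEN iffD1])

lemma c0_diff: "f \<in> c0 \<Longrightarrow> g \<in> c0 \<Longrightarrow> f - g \<in> c0"
  using c0_closed(2)[of f "- g"] c0_closed(3)[of g] by simp

text \<open>\<open>A\<^sup>\<infinity>\<close>; its norm plays no role below, only its \<open>*\<close>-ring structure does.\<close>

quotient_type (overloaded) 'a seq_alg = "nat \<Rightarrow>\<^sub>C 'a::cstar_algebra" / "\<lambda>f g. f - g \<in> c0"
proof (rule equivpI)
  show "reflp (\<lambda>f g :: nat \<Rightarrow>\<^sub>C 'a. f - g \<in> c0)" by (rule reflpI) (simp add: c0_closed)
  show "symp (\<lambda>f g :: nat \<Rightarrow>\<^sub>C 'a. f - g \<in> c0)"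
    by (rule sympI) (metis c0_closed(3) minus_diff_eq)
  show "transp (\<lambda>f g :: nat \<Rightarrow>\<^sub>C 'a. f - g \<in> c0)"
  proof (rule transpI)
    fix f g h :: "nat \<Rightarrow>\<^sub>C 'a" assume "f - g \<in> c0" "g - h \<in> c0"
    then show "f - h \<in> c0" using c0_closed(2)[of "f - g" "g - h"] by simp
  qed
qed

instantiation seq_alg :: (cstar_algebra) star_ring
begin

lift_definition zero_seq_alg :: "'a seq_alg" is 0 .

lift_definition plus_seq_alg :: "'a seq_alg \<Rightarrow> 'a seq_alg \<Rightarrow> 'a seq_alg" is "(+)"
  by (metis c0_closed(2) add_diff_add)

lift_definition uminus_seq_alg :: "'a seq_alg \<Rightarrow> 'a seq_alg" is uminus
  by (metis c0_closed(3) minus_diff_minus)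

lift_definition minus_seq_alg :: "'a seq_alg \<Rightarrow> 'a seq_alg \<Rightarrow> 'a seq_alg" is "(-)"
proof -
  fix f f' g g' :: "nat \<Rightarrow>\<^sub>C 'a" assume "f - f' \<in> c0" "g - g' \<in> c0"
  then have "(f - f') - (g - g') \<in> c0" by (rule c0_diff)
  then show "(f - g) - (f' - g') \<in> c0" by (simp add: algebra_simps)
qed

lift_definition times_seq_alg :: "'a seq_alg \<Rightarrow> 'a seq_alg \<Rightarrow> 'a seq_alg" is "(*)"
proof -
  fix f f' g g' :: "nat \<Rightarrow>\<^sub>C 'a" assume "f - f' \<in> c0" "g - g' \<in> c0"
  then have "(f - f') * g + f' * (g - g') \<in> c0" by (intro c0_closed)
  then show "f * g - f' * g' \<in> c0" by (simp add: algebra_simps)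
qed

lift_definition star_seq_alg :: "'a seq_alg \<Rightarrow> 'a seq_alg" is star
  by (metis c0_closed(6) star_diff)

instance
  by standard (transfer; simp add: c0_closed algebra_simps star_add star_mult)+

end

lift_definition const_seq :: "'a::cstar_algebra \<Rightarrow> 'a seq_alg" is const_bcontfun .

text \<open>\<open>A\<^sup>\<infinity> \<inter> A'\<close> and \<open>Ann(A, A\<^sup>\<infinity>)\<close>.\<close>

definition rel_commutant :: "'a::cstar_algebra seq_alg set"
  where "rel_commutant = {x. \<forall>a. x * const_seq a = const_seq a * x}"

definition annihilator :: "'a::cstar_algebra seq_alg set"
  where "annihilator = {x \<in> rel_commutant. \<forall>a. x * const_seq a = 0}"

lemma const_seq_simps:
  "const_seq (a * b) = const_seq a * const_seq b" "const_seq (star a) = star (const_seq a)"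
proof -
  have "const_bcontfun (a * b) = const_bcontfun a * (const_bcontfun b :: nat \<Rightarrow>\<^sub>C 'a)"
    by (rule bcontfun_eqI) simp
  then show "const_seq (a * b) = const_seq a * const_seq b"
    by transfer (simp add: c0_closed)
  have "const_bcontfun (star a) = (star (const_bcontfun a) :: nat \<Rightarrow>\<^sub>C 'a)"
    by (rule bcontfun_eqI) simp
  then show "const_seq (star a) = star (const_seq a)"
    by transfer (simp add: c0_closed)
qed

lemma rel_commutant_closed:
  fixes x y :: "'a::cstar_algebra seq_alg"
  shows "0 \<in> rel_commutant" "x \<in> rel_commutant \<Longrightarrow> - x \<in> rel_commutant"
    "x \<in> rel_commutant \<Longrightarrow> star x \<in> rel_commutant"
    "x \<in> rel_commutant \<Longrightarrow> y \<in> rel_commutant \<Longrightarrow> x + y \<in> rel_commutant"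
    "x \<in> rel_commutant \<Longrightarrow> y \<in> rel_commutant \<Longrightarrow> x - y \<in> rel_commutant"
    "x \<in> rel_commutant \<Longrightarrow> y \<in> rel_commutant \<Longrightarrow> x * y \<in> rel_commutant"
proof -
  show "star x \<in> rel_commutant" if "x \<in> rel_commutant"
    unfolding rel_commutant_def mem_Collect_eq
  proof
    fix a
    have "star (x * const_seq (star a)) = star (const_seq (star a) * x)"
      using that by (simp add: rel_commutant_def)
    then show "star x * const_seq a = const_seq a * star x"
      by (simp add: star_mult const_seq_simps)
  qed
  show "x \<in> rel_commutant \<Longrightarrow> y \<in> rel_commutant \<Longrightarrow> x * y \<in> rel_commutant"
    by (simp add: rel_commutant_def) (metis mult.assoc)
qed (simp_all add: rel_commutant_def algebra_simps)

lemma annihilator_closed: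
  fixes x y :: "'a::cstar_algebra seq_alg"
  shows "0 \<in> annihilator" "x \<in> annihilator \<Longrightarrow> - x \<in> annihilator"
    "x \<in> annihilator \<Longrightarrow> star x \<in> annihilator"
    "x \<in> annihilator \<Longrightarrow> y \<in> annihilator \<Longrightarrow> x + y \<in> annihilator"
    "x \<in> annihilator \<Longrightarrow> y \<in> annihilator \<Longrightarrow> x - y \<in> annihilator"
    "x \<in> annihilator \<Longrightarrow> y \<in> rel_commutant \<Longrightarrow> x * y \<in> annihilator"
    "x \<in> rel_commutant \<Longrightarrow> y \<in> annihilator \<Longrightarrow> x * y \<in> annihilator"
proof -
  show "star x \<in> annihilator" if x: "x \<in> annihilator"
  proof -
    have "star x * const_seq a = 0" for a
    proof -
      have "star x * const_seq a = star (const_seq (star a) * x)"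
        by (simp add: star_mult const_seq_simps)
      also have "const_seq (star a) * x = x * const_seq (star a)"
        using x by (simp add: annihilator_def rel_commutant_def)
      finally show ?thesis using x by (simp add: annihilator_def)
    qed
    then show ?thesis using x by (simp add: annihilator_def rel_commutant_closed)
  qed
  show "x * y \<in> annihilator" if xy: "x \<in> annihilator" "y \<in> rel_commutant"
  proof -
    have "x * y * const_seq a = 0" for a
    proof -
      have "x * y * const_seq a = x * const_seq a * y"
        using xy by (simp add: rel_commutant_def mult.assoc)
      then show ?thesis using xy by (simp add: annihilator_def)
    qed
    then show ?thesis using xy by (simp add: annihilator_def rel_commutant_closed)
  qed
  show "x \<in> rel_commutant \<Longrightarrow> y \<in> annihilator \<Longrightarrow> x * y \<in> annihilator"
    by (simp add: annihilator_def rel_commutant_closed mult.assoc)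
qed (simp_all add: annihilator_def rel_commutant_closed algebra_simps)

text \<open>\<open>F(A)\<close>, as a quotient of the subset \<^term>\<open>rel_commutant\<close> of \<open>A\<^sup>\<infinity>\<close>.\<close>

definition central_rel :: "'a::cstar_algebra seq_alg \<Rightarrow> 'a seq_alg \<Rightarrow> bool"
  where "central_rel x y \<longleftrightarrow>
    x \<in> rel_commutant \<and> y \<in> rel_commutant \<and> x - y \<in> annihilator"

quotient_type (overloaded) 'a central_alg = "'a::cstar_algebra seq_alg" / partial: central_rel
proof (rule part_equivpI)
  show "\<exists>x :: 'a seq_alg. central_rel x x"
    by (rule exI[of _ 0]) (simp add: central_rel_def rel_commutant_closed annihilator_closed)
  show "symp (central_rel :: 'a seq_alg \<Rightarrow> _)"
    by (rule sympI) (metis central_rel_def annihilator_closed(2) minus_diff_eq)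
  show "transp (central_rel :: 'a seq_alg \<Rightarrow> _)"
  proof (rule transpI)
    fix x y z :: "'a seq_alg" assume "central_rel x y" "central_rel y z"
    then show "central_rel x z"
      using annihilator_closed(4)[of "x - y" "y - z"] by (simp add: central_rel_def)
  qed
qed

instantiation central_alg :: (cstar_algebra) star_ring
begin

lift_definition zero_central_alg :: "'a central_alg" is 0
  by (simp add: central_rel_def rel_commutant_closed annihilator_closed)

lift_definition plus_central_alg :: "'a central_alg \<Rightarrow> 'a central_alg \<Rightarrow> 'a central_alg" is "(+)"
  by (metis central_rel_def rel_commutant_closed(4) annihilator_closed(4) add_diff_add)

lift_definition uminus_central_alg :: "'a central_alg \<Rightarrow> 'a central_alg" is uminus
  by (metis central_rel_def rel_commutant_closed(2) annihilator_closed(2) minus_diff_minus)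

lift_definition minus_central_alg :: "'a central_alg \<Rightarrow> 'a central_alg \<Rightarrow> 'a central_alg" is "(-)"
proof -
  fix x x' y y' :: "'a seq_alg" assume "central_rel x x'" "central_rel y y'"
  moreover from this have "(x - x') - (y - y') \<in> annihilator"
    by (intro annihilator_closed(5)[of "x - x'" "y - y'"]) (simp_all add: central_rel_def)
  ultimately show "central_rel (x - y) (x' - y')"
    by (simp add: central_rel_def rel_commutant_closed algebra_simps)
qed

lift_definition times_central_alg :: "'a central_alg \<Rightarrow> 'a central_alg \<Rightarrow> 'a central_alg" is "(*)"
proof -
  fix x x' y y' :: "'a seq_alg" assume "central_rel x x'" "central_rel y y'"
  moreover from this have "(x - x') * y + x' * (y - y') \<in> annihilator"
    by (intro annihilator_closed(4) annihilator_closed(6)[of "x - x'"] annihilator_closed(7)[of x'])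
      (simp_all add: central_rel_def)
  ultimately show "central_rel (x * y) (x' * y')"
    by (simp add: central_rel_def rel_commutant_closed algebra_simps)
qed

lift_definition star_central_alg :: "'a central_alg \<Rightarrow> 'a central_alg" is star
  by (metis central_rel_def rel_commutant_closed(3) annihilator_closed(3) star_diff)

instance
  by standard (transfer; simp add: central_rel_def rel_commutant_closed annihilator_closed
      algebra_simps star_add star_mult)+

end

definition is_unit_elt :: "'a::star_ring \<Rightarrow> bool"
  where "is_unit_elt u \<longleftrightarrow> (\<forall>x. u * x = x \<and> x * u = x)"

definition central_one :: "'a::cstar_algebra central_alg"
  where "central_one = (THE u. is_unit_elt u)"

lemma is_unit_elt_central_one:
  assumes "sigma_unital TYPE('a::cstar_algebra)"
  shows "is_unit_elt (central_one :: 'a central_alg)"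
proof -
  obtain e :: "nat \<Rightarrow> 'a" where e: "\<And>n. norm (e n) \<le> 1"
      "\<And>a. (\<lambda>n. e n * a) \<longlonglongrightarrow> a" "\<And>a. (\<lambda>n. a * e n) \<longlonglongrightarrow> a"
    using assms unfolding sigma_unital_def by blast
  define E where "E = Bcontfun e"
  have E: "apply_bcontfun E = e"
    unfolding E_def using e(1) by (intro Bcontfun_inverse bcontfun_normI) auto
  have e1: "abs_seq_alg E * const_seq a = const_seq a" for a
    using e(2)[of a, THEN LIM_zero]
    by (simp add: const_seq.abs_eq times_seq_alg.abs_eq seq_alg.abs_eq_iff c0_def E)
  have e2: "const_seq a * abs_seq_alg E = const_seq a" for a
    using e(3)[of a, THEN LIM_zero]
    by (simp add: const_seq.abs_eq times_seq_alg.abs_eq seq_alg.abs_eq_iff c0_def E)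
  have E_comm: "abs_seq_alg E \<in> rel_commutant" by (simp add: rel_commutant_def e1 e2)
  have ann: "abs_seq_alg E * x - x \<in> annihilator" "x * abs_seq_alg E - x \<in> annihilator"
    if x: "x \<in> rel_commutant" for x
  proof -
    have x_comm: "x * const_seq a = const_seq a * x" for a using x by (simp add: rel_commutant_def)
    have "(abs_seq_alg E * x - x) * const_seq a = 0" for a
      by (simp add: left_diff_distrib mult.assoc x_comm) (simp add: mult.assoc[symmetric] e1)
    moreover have "(x * abs_seq_alg E - x) * const_seq a = 0" for a
      by (simp add: left_diff_distrib mult.assoc e1)
    ultimately show "abs_seq_alg E * x - x \<in> annihilator" "x * abs_seq_alg E - x \<in> annihilator"
      using x E_comm by (simp_all add: annihilator_def rel_commutant_closed)
  qed
  have "is_unit_elt (abs_central_alg (abs_seq_alg E))"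
    unfolding is_unit_elt_def
  proof
    fix z :: "'a central_alg"
    define x where "x = rep_central_alg z"
    have rel: "central_rel x x" and z: "z = abs_central_alg x"
      unfolding x_def
      by (simp_all only: Quotient3_rep_reflp[OF Quotient3_central_alg]
          Quotient3_abs_rep[OF Quotient3_central_alg])
    have E_rel: "central_rel (abs_seq_alg E) (abs_seq_alg E)"
      using E_comm by (simp add: central_rel_def annihilator_closed)
    have "central_rel (abs_seq_alg E * x) x" "central_rel (x * abs_seq_alg E) x"
      using rel E_comm ann by (auto simp: central_rel_def rel_commutant_closed)
    then show "abs_central_alg (abs_seq_alg E) * z = z \<and> z * abs_central_alg (abs_seq_alg E) = z"
      unfolding z
      by (simp add: times_central_alg.abs_eq rel E_rel Quotient3_rel_abs[OF Quotient3_central_alg])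
  qed
  then obtain u :: "'a central_alg" where u: "is_unit_elt u" by blast
  show ?thesis
    unfolding central_one_def
  proof (rule theI)
    show "is_unit_elt u" by (rule u)
    show "v = u" if "is_unit_elt v" for v using that u by (metis is_unit_elt_def)
  qed
qed

section \<open>Rokhlin properties\<close>

text \<open>The map induced on \<open>A\<^sup>\<infinity>\<close> and \<open>F(A)\<close> by an automorphism, defined through representatives
  (see \<open>seq_map_abs\<close> and \<open>central_map_abs\<close> for independence of the choice).\<close>

definition seq_map :: "('a::cstar_algebra \<Rightarrow> 'a) \<Rightarrow> 'a seq_alg \<Rightarrow> 'a seq_alg"
  where "seq_map \<phi> x = abs_seq_alg (Bcontfun (\<lambda>n. \<phi> (rep_seq_alg x n)))"

definition central_map :: "('a::cstar_algebra \<Rightarrow> 'a) \<Rightarrow> 'a central_alg \<Rightarrow> 'a central_alg"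
  where "central_map \<phi> x = abs_central_alg (seq_map \<phi> (rep_central_alg x))"

lemma apply_Bcontfun_star_hom:
  fixes f :: "nat \<Rightarrow>\<^sub>C 'a::cstar_algebra"
  assumes "star_hom \<phi>"
  shows "apply_bcontfun (Bcontfun (\<lambda>n. \<phi> (f n))) = (\<lambda>n. \<phi> (f n))"
  by (intro Bcontfun_inverse bcontfun_normI[where b = "norm f"])
    (auto intro: order_trans[OF star_hom_norm_le[OF assms]] norm_bounded)

lemma seq_map_abs:
  assumes \<phi>: "star_hom \<phi>"
  shows "seq_map \<phi> (abs_seq_alg f) = abs_seq_alg (Bcontfun (\<lambda>n. \<phi> (f n)))"
proof -
  define g where "g = rep_seq_alg (abs_seq_alg f)"
  have "g - f \<in> c0"
    unfolding g_def using Quotient3_rep_abs[OF Quotient3_seq_alg] by (simp add: c0_closed)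
  then have "(\<lambda>n. norm (g n - f n)) \<longlonglongrightarrow> 0" by (auto simp: c0_def intro: tendsto_norm_zero)
  then have "(\<lambda>n. \<phi> (g n) - \<phi> (f n)) \<longlonglongrightarrow> 0"
    by (rule Lim_null_comparison[rotated])
      (simp add: star_hom_norm_le[OF \<phi>] flip: star_hom_diff[OF \<phi>])
  then show ?thesis
    unfolding seq_map_def g_def[symmetric]
    by (simp add: seq_alg.abs_eq_iff c0_def apply_Bcontfun_star_hom[OF \<phi>])
qed

lemma seq_map_hom:
  assumes \<phi>: "star_hom \<phi>"
  shows "seq_map \<phi> (x - y) = seq_map \<phi> x - seq_map \<phi> y"
    and "seq_map \<phi> (x * y) = seq_map \<phi> x * seq_map \<phi> y"
    and "seq_map \<phi> (const_seq a) = const_seq (\<phi> a)"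
    and "seq_map \<phi> 0 = 0"
proof -
  obtain f where f: "x = abs_seq_alg f" by (metis Quotient3_abs_rep[OF Quotient3_seq_alg])
  obtain g where g: "y = abs_seq_alg g" by (metis Quotient3_abs_rep[OF Quotient3_seq_alg])
  have "Bcontfun (\<lambda>n. \<phi> ((f - g) n)) = Bcontfun (\<lambda>n. \<phi> (f n)) - Bcontfun (\<lambda>n. \<phi> (g n))"
    by (rule bcontfun_eqI)
      (subst apply_Bcontfun_star_hom[OF \<phi>],
        simp add: apply_Bcontfun_star_hom[OF \<phi>] star_hom_diff[OF \<phi>])
  then show "seq_map \<phi> (x - y) = seq_map \<phi> x - seq_map \<phi> y"
    by (simp only: f g minus_seq_alg.abs_eq seq_map_abs[OF \<phi>])
  have mult: "\<phi> (a * b) = \<phi> a * \<phi> b" for a b using \<phi> by (simp add: star_hom_def)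
  have "Bcontfun (\<lambda>n. \<phi> ((f * g) n)) = Bcontfun (\<lambda>n. \<phi> (f n)) * Bcontfun (\<lambda>n. \<phi> (g n))"
    by (rule bcontfun_eqI)
      (subst apply_Bcontfun_star_hom[OF \<phi>],
        simp add: apply_Bcontfun_star_hom[OF \<phi>] mult)
  then show "seq_map \<phi> (x * y) = seq_map \<phi> x * seq_map \<phi> y"
    by (simp only: f g times_seq_alg.abs_eq seq_map_abs[OF \<phi>])
  have "Bcontfun (\<lambda>n. \<phi> (const_bcontfun a n)) = (const_bcontfun (\<phi> a) :: nat \<Rightarrow>\<^sub>C 'a)" for a
    by (rule bcontfun_eqI) (subst apply_Bcontfun_star_hom[OF \<phi>], simp)
  then show c: "seq_map \<phi> (const_seq a) = const_seq (\<phi> a)" for a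
    by (simp only: const_seq.abs_eq seq_map_abs[OF \<phi>])
  have "const_seq (0::'a) = 0" by (simp add: const_seq.abs_eq zero_seq_alg.abs_eq)
  with c[of 0] show "seq_map \<phi> 0 = 0" by (simp add: star_hom_0[OF \<phi>])
qed

lemma seq_map_rel_commutant:
  assumes "\<phi> \<in> carrier Aut"
  shows "x \<in> rel_commutant \<Longrightarrow> seq_map \<phi> x \<in> rel_commutant"
    and "x \<in> annihilator \<Longrightarrow> seq_map \<phi> x \<in> annihilator"
proof -
  have \<phi>: "star_hom \<phi>" and surj: "\<And>a. \<exists>b. a = \<phi> b"
    using assms by (auto simp: Aut_def bij_def surj_def)
  show comm: "x \<in> rel_commutant \<Longrightarrow> seq_map \<phi> x \<in> rel_commutant"
    using surj seq_map_hom(2,3)[OF \<phi>] unfolding rel_commutant_def mem_Collect_eq by metis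
  show "x \<in> annihilator \<Longrightarrow> seq_map \<phi> x \<in> annihilator"
    using surj seq_map_hom(2-4)[OF \<phi>] comm unfolding annihilator_def mem_Collect_eq by metis
qed

lemma central_map_abs:
  assumes "\<phi> \<in> carrier Aut" "x \<in> rel_commutant"
  shows "central_map \<phi> (abs_central_alg x) = abs_central_alg (seq_map \<phi> x)"
proof -
  have \<phi>: "star_hom \<phi>" using assms by (simp add: Aut_def)
  define y where "y = rep_central_alg (abs_central_alg x)"
  have "central_rel y x"
    unfolding y_def using assms
    by (intro Quotient3_rep_abs[OF Quotient3_central_alg])
      (simp add: central_rel_def annihilator_closed)
  then have "central_rel (seq_map \<phi> y) (seq_map \<phi> x)"
    using seq_map_rel_commutant[OF assms(1)] by (simp add: central_rel_def flip: seq_map_hom[OF \<phi>])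
  then show ?thesis
    unfolding central_map_def y_def[symmetric]
    by (metis Quotient3_rel_abs[OF Quotient3_central_alg])
qed

definition rokhlin :: "('g, 'm) monoid_scheme \<Rightarrow> ('g \<Rightarrow> 'a::cstar_algebra \<Rightarrow> 'a) \<Rightarrow> bool"
  where "rokhlin G \<alpha> \<longleftrightarrow>
    (\<forall>\<epsilon>>0. \<forall>F. finite F \<longrightarrow>
      (\<exists>r :: 'g \<Rightarrow> 'a.
        (\<forall>g\<in>carrier G. positive (r g) \<and> norm (r g) \<le> 1) \<and>
        (\<forall>g\<in>carrier G. \<forall>h\<in>carrier G. g \<noteq> h \<longrightarrow> r g * r h = 0) \<and>
        (\<forall>g\<in>carrier G. \<forall>h\<in>carrier G. norm (\<alpha> g (r h) - r (g \<otimes>\<^bsub>G\<^esub> h)) < \<epsilon>) \<and>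
        (\<forall>a\<in>F. \<forall>g\<in>carrier G. norm (r g * a - a * r g) < \<epsilon>) \<and>
        (\<forall>a\<in>F. norm ((\<Sum>g\<in>carrier G. r g) * a - a) < \<epsilon>)))"

definition central_sequence_rokhlin ::
    "('g, 'm) monoid_scheme \<Rightarrow> ('g \<Rightarrow> 'a::cstar_algebra \<Rightarrow> 'a) \<Rightarrow> bool"
  where "central_sequence_rokhlin G \<alpha> \<longleftrightarrow>
    (\<exists>p :: 'g \<Rightarrow> 'a central_alg.
      (\<forall>g\<in>carrier G. projection (p g)) \<and>
      (\<Sum>g\<in>carrier G. p g) = central_one \<and>
      (\<forall>g\<in>carrier G. \<forall>h\<in>carrier G. central_map (\<alpha> g) (p h) = p (g \<otimes>\<^bsub>G\<^esub> h)))"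

end

theory Submission
  imports Defs
begin

text \<open>
  Let \<open>p\<^sub>g\<close> be central Rokhlin projections. Projections with sum \<open>1\<close> are mutually orthogonal, so
  positive lifts \<open>F\<^sub>g\<close> of the \<open>p\<^sub>g\<close> to \<open>\<ell>\<^sub>\<infinity>(\<nat>, A)\<close> behave like equivariant orthogonal projections, but only
  after multiplication by a fixed element of \<open>A\<close>. Averaging an approximate unit over the finite group
  yields invariant elements \<open>e\<close> that are almost a unit on the given finite set, and the compressions
  \<open>e F\<^sub>g e\<close> satisfy the relations in norm as the index tends to infinity. They are made exactly
  orthogonal by splitting off one of them at a time: the positive and negative parts of
  \<open>X\<^sub>1 - (X\<^sub>2 + \<dots> + X\<^sub>k)\<close> are asymptotically \<open>X\<^sub>1\<close> and \<open>X\<^sub>2 + \<dots> + X\<^sub>k\<close>, and compressing \<open>X\<^sub>2, \<dots>, X\<^sub>k\<close> by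
  the negative part only replaces them by their cubes. Since \<open>e\<close> is not a projection, the result is
  close to \<open>F\<^sub>g c\<close> where \<open>c\<close> is a power of \<open>e\<close>, the same for all \<open>g\<close>, which is just as good.
  Conversely, for separable \<open>A\<close>, Rokhlin contractions \<open>r\<^sub>g\<close> for tolerance \<open>1/n\<close> and the first \<open>n\<close> elements
  of a dense sequence form a sequence that represents projections, because \<open>r\<^sub>g\<^sup>2 = r\<^sub>g (\<Sum>\<^sub>h r\<^sub>h)\<close>.
\<close>

section \<open>Square roots\<close>

lemma norm_mult_star: "norm (x * star x) = (norm (x::'a::cstar_algebra))\<^sup>2"
  using norm_star_mult_self[of "star x"] by simp

lemma norm_selfadjoint_square: "star x = x \<Longrightarrow> norm (x * x) = (norm (x::'a::cstar_algebra))\<^sup>2"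
  using norm_star_mult_self[of x] by simp

text \<open>Testing on \<open>x = star d\<close> suffices by the C*-identity. Bounds for left
  multiplication operators, among which a unit is available, thus become bounds for norms.\<close>

lemma norm_le_of_mult:
  fixes d :: "'a::cstar_algebra"
  assumes "\<And>x. norm (d * x) \<le> c * norm x" "0 \<le> c"
  shows "norm d \<le> c"
proof (cases "d = 0")
  case False
  have "norm d * norm d \<le> c * norm d"
    using assms(1)[of "star d"] by (simp add: norm_mult_star power2_eq_square)
  then show ?thesis using False by simp
qed (use assms in simp)

lemma scaleC_diff_right: "scaleC c (x - y) = scaleC c x - scaleC c (y::'a::cstar_algebra)"
  using scaleC_add_right[of c "x - y" y] by (simp add: eq_diff_eq)

lemma scaleC_minus_left: "scaleC (- c) x = - scaleC c (x::'a::cstar_algebra)"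
  using scaleC_scaleC[of "-1" c x] scaleC_of_real[of "-1" "scaleC c x"] by simp

text \<open>The algebra may have no unit, so the multiplier \<open>1 - 2 a^2\<close> is treated
  through its action on \<open>x\<close>. Its contractivity is the starting point for positivity of
  squares.\<close>

lemma norm_one_minus_two_squares:
  fixes a :: "'a::cstar_algebra"
  assumes a: "star a = a" "norm a < 1"
  shows "norm (x - 2 *\<^sub>R (a * (a * x))) \<le> norm x"
proof -
  obtain s where s: "star s = s" "s * a = a * s" "s + s = a * a + s * s"
    by (rule quadratic_fixed_point[OF a])
  \<comment> \<open>\<open>U (\<plusminus> i)\<close> is multiplication by \<open>u = a \<plusminus> i(1 - s)\<close> and its adjoint, where \<open>u\<close> is unitary, and
    \<open>2a\<^sup>2 - 1 = (u\<^sup>2 + (u*)\<^sup>2) / 2\<close>.\<close>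
  define U where "U c y = a * y + scaleC c (y - s * y)" for c y
  have sa: "s * (a * y) = a * (s * y)" for y using s(2) by (metis mult.assoc)
  \<comment> \<open>This is \<open>(1 - s)^2 = 1 - a^2\<close>, the relation that makes
    \<open>u\<close> unitary.\<close>
  have ss: "s * (s * y) = s * y + s * y - a * (a * y)" for y
  proof -
    have "(s + s) * y = (a * a + s * s) * y" using s(3) by simp
    then show ?thesis by (simp add: distrib_right mult.assoc)
  qed
  have cc: "scaleC c (scaleC c y) = - y" if "c = \<i> \<or> c = - \<i>" for c and y :: 'a
    using that scaleC_of_real[of "-1" y] by (auto simp: scaleC_scaleC)
  have U_norm: "norm (U c y) = norm y" if c: "c = \<i> \<or> c = - \<i>" for c y
  proof -
    define q where "q = y - s * y"
    have cross: "star (a * y) * q = star q * (a * y)"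
      by (simp add: q_def star_diff star_mult a s left_diff_distrib right_diff_distrib mult.assoc sa)
    have "star (U c y) * U c y = star (a * y) * (a * y) + scaleC (cnj c * c) (star q * q)
        + (scaleC c (star (a * y) * q) + scaleC (cnj c) (star q * (a * y)))"
      by (simp add: U_def q_def[symmetric] star_add star_scaleC distrib_left distrib_right mult_scaleC_left
          mult_scaleC_right scaleC_scaleC scaleC_add_right mult.commute)
    also have "\<dots> = star (a * y) * (a * y) + star q * q"
    proof -
      have "scaleC (cnj c * c) (star q * q) = star q * q"
        using c scaleC_of_real[of 1 "star q * q"] by auto
      moreover have "scaleC c (star (a * y) * q) + scaleC (cnj c) (star q * (a * y)) = 0"
        using c by (auto simp: cross scaleC_minus_left)
      ultimately show ?thesis by simp
    qed
    also have "\<dots> = star y * y"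
      by (simp add: q_def star_diff star_mult a s left_diff_distrib right_diff_distrib distrib_left mult.assoc sa ss)
    finally have "(norm (U c y))\<^sup>2 = (norm y)\<^sup>2" by (metis norm_star_mult_self)
    then show ?thesis by (simp add: power2_eq_iff_nonneg)
  qed
  have "U c (U c x) = a * (a * x) + scaleC c (a * (x - s * x) + a * x - s * (a * x)) -
      ((x - s * x) - s * (x - s * x))" if c: "c = \<i> \<or> c = - \<i>" for c
    using cc[OF c]
    by (simp add: U_def distrib_left right_diff_distrib scaleC_add_right scaleC_diff_right mult_scaleC_right)
  moreover have "(x - s * x) - s * (x - s * x) = x - a * (a * x)"
    by (simp add: right_diff_distrib ss)
  ultimately have "U \<i> (U \<i> x) + U (- \<i>) (U (- \<i>) x) =
      a * (a * x) + a * (a * x) - (x - a * (a * x)) - (x - a * (a * x))"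
    by (simp add: scaleC_minus_left)
  also have "\<dots> = - (2 *\<^sub>R (x - 2 *\<^sub>R (a * (a * x))))" by (simp add: scaleR_2)
  finally have "U \<i> (U \<i> x) + U (- \<i>) (U (- \<i>) x) = - (2 *\<^sub>R (x - 2 *\<^sub>R (a * (a * x))))" .
  then have "2 * norm (x - 2 *\<^sub>R (a * (a * x))) = norm (U \<i> (U \<i> x) + U (- \<i>) (U (- \<i>) x))"
    by simp
  also have "\<dots> \<le> norm x + norm x"
    by (rule order_trans[OF norm_triangle_ineq]) (simp add: U_norm)
  finally show ?thesis by simp
qed

text \<open>The fixed point construction needs norm strictly below 1, so \<open>b\<close> is divided
  by some \<open>k > norm b\<close>; letting \<open>k\<close> decrease to \<open>c\<close> includes
  the boundary case.\<close>

lemma norm_shifted_square_le: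
  fixes b :: "'a::cstar_algebra"
  assumes b: "star b = b" and c: "norm b \<le> c"
  shows "norm (c\<^sup>2 *\<^sub>R x - 2 *\<^sub>R (b * b * x)) \<le> c\<^sup>2 * norm x"
proof -
  have strict: "norm (k\<^sup>2 *\<^sub>R x - 2 *\<^sub>R (b * b * x)) \<le> k\<^sup>2 * norm x" if k: "norm b < k" for k
  proof -
    have k0: "0 < k" using k norm_ge_zero[of b] by linarith
    define a where "a = (1/k) *\<^sub>R b"
    have "norm (x - 2 *\<^sub>R (a * (a * x))) \<le> norm x"
      by (rule norm_one_minus_two_squares) (use k k0 b in \<open>simp_all add: a_def star_scaleR\<close>)
    then have "norm (k\<^sup>2 *\<^sub>R (x - 2 *\<^sub>R (a * (a * x)))) \<le> k\<^sup>2 * norm x"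
      by (simp add: mult_left_mono)
    moreover have "k\<^sup>2 *\<^sub>R (x - 2 *\<^sub>R (a * (a * x))) = k\<^sup>2 *\<^sub>R x - 2 *\<^sub>R (b * b * x)"
      using k0 by (simp add: a_def scaleR_diff_right mult.assoc power2_eq_square)
    ultimately show ?thesis by simp
  qed
  have "((\<lambda>k. norm (k\<^sup>2 *\<^sub>R x - 2 *\<^sub>R (b * b * x))) \<longlongrightarrow> norm (c\<^sup>2 *\<^sub>R x - 2 *\<^sub>R (b * b * x))) (at_right c)"
    by (intro tendsto_intros)
  moreover have "((\<lambda>k. k\<^sup>2 * norm x) \<longlongrightarrow> c\<^sup>2 * norm x) (at_right c)"
    by (intro tendsto_intros)
  moreover have "\<forall>\<^sub>F k in at_right c. norm (k\<^sup>2 *\<^sub>R x - 2 *\<^sub>R (b * b * x)) \<le> k\<^sup>2 * norm x"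
    using eventually_at_right_less[of c] by eventually_elim (use c strict in auto)
  ultimately show ?thesis by (intro tendsto_le[OF trivial_limit_at_right_real])
qed

text \<open>In the unitization, \<open>z = 1 - \<surd>a\<close> solves \<open>z = ((1 - a) + z\<^sup>2) / 2\<close>. The iterates \<open>z\<^sub>k\<close> of this
  equation starting at \<open>0\<close> are split into a scalar and an element of the algebra,
  \<open>z\<^sub>k = sqrt_one k - sqrt_iter k a\<close>; the scalars are the iterates for \<open>a = 0\<close>, and they dominate both \<open>z\<^sub>k\<close>
  and \<open>z\<^sub>k\<^sub>+\<^sub>1 - z\<^sub>k\<close> in norm.\<close>

fun sqrt_one :: "nat \<Rightarrow> real" where
  "sqrt_one 0 = 0"
| "sqrt_one (Suc k) = (1 + (sqrt_one k)\<^sup>2) / 2"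

fun sqrt_iter :: "nat \<Rightarrow> 'a::cstar_algebra \<Rightarrow> 'a" where
  "sqrt_iter 0 a = 0"
| "sqrt_iter (Suc k) a = (1/2) *\<^sub>R (a + (2 * sqrt_one k) *\<^sub>R sqrt_iter k a - sqrt_iter k a * sqrt_iter k a)"

text \<open>The iterates tend to \<open>1 - sqrt a\<close> and their scalar parts to 1, so the
  algebra parts tend to the root of \<open>a\<close>. Convergence is shown for \<open>a\<close> with
  \<open>norm (x - a * x) <= norm x\<close> for all \<open>x\<close>.\<close>

definition cstar_sqrt :: "'a::cstar_algebra \<Rightarrow> 'a"
  where "cstar_sqrt a = lim (\<lambda>k. sqrt_iter k a)"

lemma sqrt_one_bounds: "0 \<le> sqrt_one k" "sqrt_one k \<le> 1" "sqrt_one k \<le> sqrt_one (Suc k)"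
proof -
  show k: "0 \<le> sqrt_one k" "sqrt_one k \<le> 1" for k
    by (induction k) (auto simp: power_le_one)
  have "0 \<le> (1 - sqrt_one k)\<^sup>2" by simp
  then show "sqrt_one k \<le> sqrt_one (Suc k)" by (simp add: power2_eq_square algebra_simps)
qed

lemma sqrt_one_tendsto: "sqrt_one \<longlonglongrightarrow> 1"
proof -
  have "incseq sqrt_one" by (rule incseq_SucI) (rule sqrt_one_bounds)
  then obtain L :: real where L: "sqrt_one \<longlonglongrightarrow> L"
    using incseq_convergent[of sqrt_one 1] sqrt_one_bounds(2) by blast
  have "(\<lambda>k. (1 + (sqrt_one k)\<^sup>2) / 2) \<longlonglongrightarrow> (1 + L\<^sup>2) / 2" by (intro tendsto_intros L) simp
  moreover have "(\<lambda>k. (1 + (sqrt_one k)\<^sup>2) / 2) \<longlonglongrightarrow> L" using LIMSEQ_Suc[OF L] by simp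
  ultimately have "(1 + L\<^sup>2) / 2 = L" by (rule LIMSEQ_unique)
  then have "(L - 1)\<^sup>2 = 0" by (simp add: power2_eq_square algebra_simps)
  then show ?thesis using L by simp
qed

text \<open>Majorant method: \<open>Z k\<close> is the \<open>k\<close>-th iterate as a multiplier,
  and since \<open>1 - a\<close> is contractive, taking norms in its recursion reproduces the scalar
  recursion.\<close>

lemma sqrt_iter_bounds:
  fixes a :: "'a::cstar_algebra"
  assumes a: "\<And>x. norm (x - a * x) \<le> norm x"
  shows "norm (sqrt_one k *\<^sub>R x - sqrt_iter k a * x) \<le> sqrt_one k * norm x"
    and "norm (sqrt_iter (Suc k) a - sqrt_iter k a) \<le> 2 * (sqrt_one (Suc k) - sqrt_one k)"
proof -
  define Z where "Z k x = sqrt_one k *\<^sub>R x - sqrt_iter k a * x" for k x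
  have Z_Suc: "Z (Suc k) x = (1/2) *\<^sub>R ((x - a * x) + Z k (Z k x))" for k x
    by (simp add: Z_def algebra_simps power2_eq_square flip: scaleR_add_left)
  have Z_bound: "norm (Z k x) \<le> sqrt_one k * norm x" for k x
  proof (induction k arbitrary: x)
    case 0
    then show ?case by (simp add: Z_def)
  next
    case (Suc k)
    have "norm (Z k (Z k x)) \<le> sqrt_one k * (sqrt_one k * norm x)"
      using Suc[of "Z k x"] Suc[of x] sqrt_one_bounds(1)[of k] by (meson mult_left_mono order_trans)
    then have "norm ((x - a * x) + Z k (Z k x)) \<le> norm x + sqrt_one k * (sqrt_one k * norm x)"
      using a[of x] norm_triangle_ineq[of "x - a * x" "Z k (Z k x)"] by linarith
    then show ?case by (simp add: Z_Suc power2_eq_square distrib_left distrib_right add_divide_distrib)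
  qed
  then show "norm (sqrt_one k *\<^sub>R x - sqrt_iter k a * x) \<le> sqrt_one k * norm x" by (simp add: Z_def)
  have Z_diff: "Z k (x - y) = Z k x - Z k y" for k x y
    by (simp add: Z_def algebra_simps)
  have step: "norm (Z (Suc k) x - Z k x) \<le> (sqrt_one (Suc k) - sqrt_one k) * norm x" for k x
  proof (induction k arbitrary: x)
    case 0
    then show ?case using a[of x] by (simp add: Z_Suc) (simp add: Z_def)
  next
    case (Suc k)
    let ?p = "sqrt_one (Suc k)" and ?q = "sqrt_one k"
    have p: "0 \<le> ?p" "0 \<le> ?p - ?q" using sqrt_one_bounds[of "k"] by simp_all
    have "norm (Z (Suc k) (Z (Suc k) x - Z k x)) \<le> ?p * ((?p - ?q) * norm x)"
      by (rule order_trans[OF Z_bound mult_left_mono[OF Suc p(1)]])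
    moreover have "norm (Z (Suc k) (Z k x) - Z k (Z k x)) \<le> (?p - ?q) * (?q * norm x)"
      by (rule order_trans[OF Suc mult_left_mono[OF Z_bound p(2)]])
    \<comment> \<open>The splitting \<open>p^2 - q^2 = p (p - q) + (p - q) q\<close> for
      \<open>p = Z (Suc k)\<close> and \<open>q = Z k\<close>.\<close>
    moreover have eq: "Z (Suc (Suc k)) x - Z (Suc k) x = (1/2) *\<^sub>R (Z (Suc k) (Z (Suc k) x - Z k x) +
        (Z (Suc k) (Z k x) - Z k (Z k x)))"
      by (simp only: Z_Suc[of "Suc k"] Z_Suc[of k x] Z_diff) (simp add: algebra_simps)
    moreover have "norm (Z (Suc k) (Z (Suc k) x - Z k x) + (Z (Suc k) (Z k x) - Z k (Z k x))) \<le>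
       norm (Z (Suc k) (Z (Suc k) x - Z k x)) + norm (Z (Suc k) (Z k x) - Z k (Z k x))"
      by (rule norm_triangle_ineq)
    ultimately have "2 * norm (Z (Suc (Suc k)) x - Z (Suc k) x) \<le>
       ?p * ((?p - ?q) * norm x) + (?p - ?q) * (?q * norm x)" by simp
    also have "\<dots> = 2 * ((sqrt_one (Suc (Suc k)) - ?p) * norm x)"
    proof -
      have "sqrt_one (Suc (Suc k)) = (1 + ?p\<^sup>2) / 2" by simp
      moreover have "?p = (1 + ?q\<^sup>2) / 2" by simp
      ultimately have "sqrt_one (Suc (Suc k)) - ?p = (?p\<^sup>2 - ?q\<^sup>2) / 2"
        by (metis add_diff_cancel_left diff_divide_distrib)
      then have *: "sqrt_one (Suc (Suc k)) - ?p = (?p - ?q) * (?p + ?q) / 2"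
        by (simp add: power2_eq_square algebra_simps del: sqrt_one.simps)
      show ?thesis unfolding * by (simp add: algebra_simps del: sqrt_one.simps)
    qed
    finally show ?case by linarith
  qed
  have pq: "0 \<le> sqrt_one (Suc k) - sqrt_one k" using sqrt_one_bounds(3)[of k] by simp
  show "norm (sqrt_iter (Suc k) a - sqrt_iter k a) \<le> 2 * (sqrt_one (Suc k) - sqrt_one k)"
  proof (rule norm_le_of_mult)
    fix x
    let ?d = "sqrt_one (Suc k) - sqrt_one k"
    \<comment> \<open>The scalar part contributes one increment and the change of \<open>Z\<close>
      another, hence the factor 2.\<close>
    have "(sqrt_iter (Suc k) a - sqrt_iter k a) * x = ?d *\<^sub>R x - (Z (Suc k) x - Z k x)"
      by (simp add: Z_def algebra_simps del: sqrt_one.simps sqrt_iter.simps)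
    also have "norm \<dots> \<le> ?d * norm x + ?d * norm x"
      using step[of k x] pq by (intro order_trans[OF norm_triangle_ineq4[of "?d *\<^sub>R x"]] add_mono) (simp_all del: sqrt_one.simps)
    finally show "norm ((sqrt_iter (Suc k) a - sqrt_iter k a) * x) \<le> 2 * ?d * norm x"
      by (simp add: algebra_simps del: sqrt_one.simps sqrt_iter.simps)
  qed (use pq in simp)
qed

text \<open>Increments telescope against the convergent sequence \<open>sqrt_one\<close>. The error
  bound depends on \<open>k\<close> alone, so convergence is uniform in \<open>a\<close>.\<close>

lemma sqrt_iter_approx:
  fixes a :: "'a::cstar_algebra"
  assumes a: "\<And>x. norm (x - a * x) \<le> norm x"
  shows "(\<lambda>k. sqrt_iter k a) \<longlonglongrightarrow> cstar_sqrt a"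
    and "norm (cstar_sqrt a - sqrt_iter k a) \<le> 2 * (1 - sqrt_one k)"
    and "norm (sqrt_iter k a) \<le> 2"
proof -
  have diff: "norm (sqrt_iter (k + m) a - sqrt_iter k a) \<le> 2 * (sqrt_one (k + m) - sqrt_one k)" for k m
  proof (induction m)
    case (Suc m)
    have "norm (sqrt_iter (Suc (k + m)) a - sqrt_iter k a) \<le>
        norm (sqrt_iter (Suc (k + m)) a - sqrt_iter (k + m) a) + norm (sqrt_iter (k + m) a - sqrt_iter k a)"
      using norm_triangle_ineq[of "sqrt_iter (Suc (k + m)) a - sqrt_iter (k + m) a"
          "sqrt_iter (k + m) a - sqrt_iter k a"] by (simp del: sqrt_iter.simps)
    then show ?case using Suc sqrt_iter_bounds(2)[OF a, of "k + m"]
      by (simp del: sqrt_iter.simps sqrt_one.simps)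
  qed simp
  have "Cauchy (\<lambda>k. sqrt_iter k a)"
  proof (rule CauchyI')
    fix e :: real assume "0 < e"
    with sqrt_one_tendsto have "\<forall>\<^sub>F k in sequentially. dist (sqrt_one k) 1 < e / 2"
      by (intro tendstoD) auto
    then obtain M where M: "\<And>k. M \<le> k \<Longrightarrow> dist (sqrt_one k) 1 < e / 2"
      by (auto simp: eventually_sequentially)
    show "\<exists>M. \<forall>m\<ge>M. \<forall>n>m. dist (sqrt_iter m a) (sqrt_iter n a) < e"
    proof (intro exI allI impI)
      fix m n assume mn: "M \<le> m" "m < n"
      then obtain d where d: "n = m + d" by (metis less_imp_add_positive)
      show "dist (sqrt_iter m a) (sqrt_iter n a) < e"
        using diff[of m d] M[OF mn(1)] sqrt_one_bounds(2)[of m] sqrt_one_bounds(2)[of "m + d"]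
        by (simp add: dist_norm norm_minus_commute[of "sqrt_iter m a"] d dist_real_def)
    qed
  qed
  then show lim: "(\<lambda>k. sqrt_iter k a) \<longlonglongrightarrow> cstar_sqrt a"
    unfolding cstar_sqrt_def by (intro convergent_LIMSEQ_iff[THEN iffD1] Cauchy_convergent)
  show "norm (cstar_sqrt a - sqrt_iter k a) \<le> 2 * (1 - sqrt_one k)"
  proof (rule Lim_bounded)
    show "(\<lambda>m. norm (sqrt_iter m a - sqrt_iter k a)) \<longlonglongrightarrow> norm (cstar_sqrt a - sqrt_iter k a)"
      by (intro tendsto_intros lim)
    show "\<forall>m\<ge>k. norm (sqrt_iter m a - sqrt_iter k a) \<le> 2 * (1 - sqrt_one k)"
    proof (intro allI impI)
      fix m assume "k \<le> m"
      then obtain d where "m = k + d" by (metis le_iff_add)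
      then show "norm (sqrt_iter m a - sqrt_iter k a) \<le> 2 * (1 - sqrt_one k)"
        using diff[of k d] sqrt_one_bounds(2)[of "k + d"] by simp
    qed
  qed
  show "norm (sqrt_iter k a) \<le> 2" using diff[of 0 k] sqrt_one_bounds(2)[of k] by simp
qed

text \<open>All properties pass to the limit from the iterates. In the limit the recursion reads
  \<open>2 w = a + 2 w - w^2\<close>, that is, \<open>w^2 = a\<close>.\<close>

lemma cstar_sqrt:
  fixes a :: "'a::cstar_algebra"
  assumes sa: "star a = a" and a: "\<And>x. norm (x - a * x) \<le> norm x"
  shows "star (cstar_sqrt a) = cstar_sqrt a"
    and "cstar_sqrt a * cstar_sqrt a = a"
    and "y * a = a * y \<Longrightarrow> y * cstar_sqrt a = cstar_sqrt a * y"
    and "norm (x - cstar_sqrt a * x) \<le> norm x"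
proof -
  note lim = sqrt_iter_approx(1)[OF a]
  have "star (sqrt_iter k a) = sqrt_iter k a" for k
    by (induction k) (simp_all add: sa star_add star_diff star_scaleR star_mult)
  moreover have "(\<lambda>k. star (sqrt_iter k a)) \<longlonglongrightarrow> star (cstar_sqrt a)"
    by (rule continuous_on_tendsto_compose[OF continuous_on_star[of UNIV] lim]) auto
  ultimately have "(\<lambda>k. sqrt_iter k a) \<longlonglongrightarrow> star (cstar_sqrt a)" by simp
  then show "star (cstar_sqrt a) = cstar_sqrt a" by (rule LIMSEQ_unique[OF _ lim])
  have "(\<lambda>k. sqrt_iter (Suc k) a) \<longlonglongrightarrow>
     (1/2) *\<^sub>R (a + (2 * 1) *\<^sub>R cstar_sqrt a - cstar_sqrt a * cstar_sqrt a)"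
    unfolding sqrt_iter.simps by (intro tendsto_intros lim sqrt_one_tendsto)
  from LIMSEQ_unique[OF this LIMSEQ_Suc[OF lim]]
  have "2 *\<^sub>R ((1/2) *\<^sub>R (a + (2 * 1) *\<^sub>R cstar_sqrt a - cstar_sqrt a * cstar_sqrt a)) = 2 *\<^sub>R cstar_sqrt a"
    by (rule arg_cong)
  then show "cstar_sqrt a * cstar_sqrt a = a" by simp
  show "y * cstar_sqrt a = cstar_sqrt a * y" if y: "y * a = a * y"
  proof -
    have "y * sqrt_iter k a = sqrt_iter k a * y" for k
    proof (induction k)
      case (Suc k)
      have "y * (sqrt_iter k a * sqrt_iter k a) = sqrt_iter k a * (sqrt_iter k a * y)"
        by (metis Suc mult.assoc)
      with Suc y show ?case by (simp add: algebra_simps)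
    qed simp
    moreover have "(\<lambda>k. y * sqrt_iter k a) \<longlonglongrightarrow> y * cstar_sqrt a"
      by (intro tendsto_intros lim)
    ultimately have "(\<lambda>k. sqrt_iter k a * y) \<longlonglongrightarrow> y * cstar_sqrt a" by simp
    moreover have "(\<lambda>k. sqrt_iter k a * y) \<longlonglongrightarrow> cstar_sqrt a * y"
      by (intro tendsto_intros lim)
    ultimately show ?thesis by (rule LIMSEQ_unique)
  qed
  have "(\<lambda>k. norm (sqrt_one k *\<^sub>R x - sqrt_iter k a * x)) \<longlonglongrightarrow> norm (1 *\<^sub>R x - cstar_sqrt a * x)"
    by (intro tendsto_intros lim sqrt_one_tendsto)
  moreover have "norm (sqrt_one k *\<^sub>R x - sqrt_iter k a * x) \<le> norm x" for k
    using sqrt_iter_bounds(1)[OF a, where k = k and x = x] sqrt_one_bounds(2)[of k]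
      mult_right_mono[of "sqrt_one k" 1 "norm x"] by simp
  ultimately show "norm (x - cstar_sqrt a * x) \<le> norm x"
    using Lim_bounded[of _ _ 0] by fastforce
qed

section \<open>Positive elements\<close>

text \<open>\<open>\<parallel>t - a\<parallel> \<le> t\<close> in the multiplier norm says that the spectrum of \<open>a\<close> lies in \<open>[0, 2t]\<close>.\<close>

definition nonneg :: "'a::cstar_algebra \<Rightarrow> bool"
  where "nonneg a \<longleftrightarrow> star a = a \<and> (\<exists>t\<ge>0. \<forall>x. norm (t *\<^sub>R x - a * x) \<le> t * norm x)"

text \<open>For \<open>t = (norm w)^2 / 2\<close> the condition is
  \<open>norm_shifted_square_le\<close> at \<open>c = norm w\<close>, divided by 2.\<close>

lemma nonneg_square:
  fixes w :: "'a::cstar_algebra"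
  assumes w: "star w = w"
  shows "nonneg (w * w)"
  unfolding nonneg_def
proof (intro conjI exI allI)
  fix x
  have "2 *\<^sub>R (((norm w)\<^sup>2 / 2) *\<^sub>R x - w * w * x) = (norm w)\<^sup>2 *\<^sub>R x - 2 *\<^sub>R (w * w * x)"
    by (simp add: scaleR_diff_right)
  then have "2 * norm (((norm w)\<^sup>2 / 2) *\<^sub>R x - w * w * x) = norm ((norm w)\<^sup>2 *\<^sub>R x - 2 *\<^sub>R (w * w * x))"
    by (metis abs_numeral norm_scaleR)
  then show "norm (((norm w)\<^sup>2 / 2) *\<^sub>R x - w * w * x) \<le> (norm w)\<^sup>2 / 2 * norm x"
    using norm_shifted_square_le[OF w order_refl, of x] by simp
qed (simp_all add: star_mult w)

lemma unit_shift_scaled: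
  fixes a :: "'a::cstar_algebra"
  assumes t: "0 < t" and a: "norm (t *\<^sub>R x - a * x) \<le> t * norm x"
  shows "norm (x - (1 / t) *\<^sub>R a * x) \<le> norm x"
proof -
  have "t *\<^sub>R (x - (1 / t) *\<^sub>R a * x) = t *\<^sub>R x - a * x"
    using t by (simp add: scaleR_diff_right)
  then have "t * norm (x - (1 / t) *\<^sub>R a * x) \<le> t * norm x"
    using a t by (metis abs_of_pos norm_scaleR)
  then show ?thesis using t by simp
qed

text \<open>The hypothesis brings \<open>a / t^2\<close> into the domain where
  \<open>cstar_sqrt\<close> is controlled. The root is given by a formula, so that roots taken at a
  common scale \<open>t\<close> can be compared later.\<close>

lemma scaled_sqrt:
  fixes a :: "'a::cstar_algebra"
  assumes sa: "star a = a" and t: "0 < t" and a: "\<And>x. norm (t\<^sup>2 *\<^sub>R x - a * x) \<le> t\<^sup>2 * norm x"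
  defines "w \<equiv> t *\<^sub>R cstar_sqrt ((1 / t\<^sup>2) *\<^sub>R a)"
  shows "star w = w" "w * w = a" "y * a = a * y \<Longrightarrow> y * w = w * y" "nonneg w" "norm w \<le> 2 * t"
proof -
  define b where "b = (1 / t\<^sup>2) *\<^sub>R a"
  have sb: "star b = b" by (simp add: b_def star_scaleR sa)
  have b: "norm (x - b * x) \<le> norm x" for x
    unfolding b_def by (rule unit_shift_scaled) (use t a in simp_all)
  note s = cstar_sqrt[OF sb b]
  have w: "w = t *\<^sub>R cstar_sqrt b" by (simp add: w_def b_def)
  show star: "star w = w" by (simp add: w star_scaleR s(1))
  have "w * w = t\<^sup>2 *\<^sub>R b" by (simp add: w s(2) power2_eq_square)
  then show "w * w = a" using t by (simp add: b_def)
  show "y * w = w * y" if "y * a = a * y"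
    using that s(3)[of y] by (simp add: w b_def)
  have shift: "norm (t *\<^sub>R x - w * x) \<le> t * norm x" for x
  proof -
    have "t *\<^sub>R x - w * x = t *\<^sub>R (x - cstar_sqrt b * x)" by (simp add: w scaleR_diff_right)
    then show ?thesis using s(4)[of x] t by (simp add: mult_left_mono)
  qed
  then show "nonneg w" using star t by (auto simp: nonneg_def intro!: exI[of _ t])
  show "norm w \<le> 2 * t"
  proof (rule norm_le_of_mult)
    show "norm (w * x) \<le> 2 * t * norm x" for x
      using norm_triangle_ineq4[of "t *\<^sub>R x" "t *\<^sub>R x - w * x"] shift[of x] t by simp
  qed (use t in simp)
qed

lemma nonneg_sqrtE:
  fixes a :: "'a::cstar_algebra"
  assumes "nonneg a"
  obtains w where "star w = w" "w * w = a" "\<And>y. y * a = a * y \<Longrightarrow> y * w = w * y" "nonneg w"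
proof -
  obtain t where sa: "star a = a" and t: "0 \<le> t" "\<And>x. norm (t *\<^sub>R x - a * x) \<le> t * norm x"
    using assms by (auto simp: nonneg_def)
  show thesis
  proof (cases "t = 0")
    case True
    \<comment> \<open>No rescaling is possible for \<open>t = 0\<close>, but the bound then says
      that \<open>a\<close> annihilates everything.\<close>
    then have "a * star a = 0" using t(2)[of "star a"] by simp
    then have "a = 0" using norm_mult_star[of a] by simp
    then show thesis by (intro that[of 0]) (auto simp: nonneg_def intro: exI[of _ 0])
  next
    case False
    then have "0 < sqrt t" "\<And>x. norm ((sqrt t)\<^sup>2 *\<^sub>R x - a * x) \<le> (sqrt t)\<^sup>2 * norm x"
      using t by simp_all
    from scaled_sqrt[OF sa this] show thesis using that by blast
  qed
qed

lemma nonneg_star: "nonneg a \<Longrightarrow> star a = a"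
  by (simp add: nonneg_def)

lemma nonneg_shift:
  fixes a :: "'a::cstar_algebra"
  assumes a: "nonneg a" and t: "norm a / 2 \<le> t"
  shows "norm (t *\<^sub>R x - a * x) \<le> t * norm x"
proof -
  obtain w where w: "star w = w" "w * w = a" using nonneg_sqrtE[OF a] by metis
  have n: "norm a = (norm w)\<^sup>2" using norm_selfadjoint_square[OF w(1)] w(2) by simp
  have "2 *\<^sub>R (t *\<^sub>R x - a * x) = (2 * t - norm a) *\<^sub>R x + (norm a *\<^sub>R x - 2 *\<^sub>R (a * x))"
    by (simp add: algebra_simps)
  then have "2 * norm (t *\<^sub>R x - a * x) = norm ((2 * t - norm a) *\<^sub>R x + (norm a *\<^sub>R x - 2 *\<^sub>R (a * x)))"
    by (metis abs_numeral norm_scaleR)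
  also have "\<dots> \<le> (2 * t - norm a) * norm x + norm a * norm x"
    using norm_shifted_square_le[OF w(1) order_refl, of x] t
    by (intro order_trans[OF norm_triangle_ineq] add_mono) (auto simp: n w(2))
  finally show ?thesis by (simp add: algebra_simps)
qed

text \<open>Shifts add up, whereas a sum of elements \<open>star y * y\<close> is not visibly of
  that form again.\<close>

lemma nonneg_add:
  fixes a b :: "'a::cstar_algebra"
  assumes "nonneg a" "nonneg b"
  shows "nonneg (a + b)"
proof -
  obtain s t where *: "0 \<le> s" "\<And>x. norm (s *\<^sub>R x - a * x) \<le> s * norm x"
      "0 \<le> t" "\<And>x. norm (t *\<^sub>R x - b * x) \<le> t * norm x"
    using assms unfolding nonneg_def by metis
  have "norm ((s + t) *\<^sub>R x - (a + b) * x) \<le> (s + t) * norm x" for x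
    using norm_triangle_ineq[of "s *\<^sub>R x - a * x" "t *\<^sub>R x - b * x"] *(2,4)[of x]
    by (simp add: algebra_simps)
  then show ?thesis
    using assms *(1,3) by (auto simp: nonneg_def star_add intro!: exI[of _ "s + t"])
qed

text \<open>By convexity of \<open>t \<mapsto> \<parallel>a + t\<parallel>\<close> on \<open>[-\<parallel>a\<parallel>/2, s]\<close>, whose values at \<open>-\<parallel>a\<parallel>/2\<close> and \<open>0\<close> are known.\<close>

lemma norm_nonneg_shift_ge:
  fixes a :: "'a::cstar_algebra"
  assumes a: "nonneg a" "a \<noteq> 0" and s: "0 \<le> s" and c: "\<And>x. norm (s *\<^sub>R x + a * x) \<le> c * norm x"
  shows "norm a + s \<le> c"
proof -
  let ?n = "norm a"
  have n: "0 < ?n" using a by simp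
  \<comment> \<open>\<open>0\<close> is the convex combination of \<open>s\<close> and
    \<open>-?n / 2\<close> with weights proportional to \<open>?n / 2\<close> and \<open>s\<close>;
    the identity is this combination, multiplied by \<open>a\<close> and by the total
    weight.\<close>
  have "(s + ?n / 2) *\<^sub>R (a * a) = (?n / 2) *\<^sub>R (s *\<^sub>R a + a * a) + (- s) *\<^sub>R ((?n / 2) *\<^sub>R a - a * a)"
    by (simp add: algebra_simps)
  then have "norm ((s + ?n / 2) *\<^sub>R (a * a)) \<le>
      norm ((?n / 2) *\<^sub>R (s *\<^sub>R a + a * a)) + norm ((- s) *\<^sub>R ((?n / 2) *\<^sub>R a - a * a))"
    by (metis norm_triangle_ineq)
  then have "(s + ?n / 2) * norm (a * a) \<le>
      (?n / 2) * norm (s *\<^sub>R a + a * a) + s * norm ((?n / 2) *\<^sub>R a - a * a)"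
    using s n by (simp add: abs_of_nonneg)
  also have "\<dots> \<le> (?n / 2) * (c * ?n) + s * (?n / 2 * ?n)"
    using c[of a] nonneg_shift[OF a(1) order_refl, of a] s n
    by (intro add_mono mult_left_mono) auto
  finally have "(?n * ?n) * (s + ?n / 2) \<le> (?n * ?n) * (c / 2 + s / 2)"
    using norm_selfadjoint_square[OF nonneg_star[OF a(1)]] by (simp add: power2_eq_square algebra_simps)
  then show ?thesis using n by simp
qed

text \<open>\<open>a + (M - c / 2)\<close> equals \<open>(M - b) - (c / 2 - (a + b))\<close>, of
  multiplier norm at most \<open>M + c / 2\<close>, while \<open>norm_nonneg_shift_ge\<close> bounds
  it from below. \<open>M\<close> has to be at least \<open>norm b / 2\<close> and
  \<open>c / 2\<close>.\<close>

lemma nonneg_norm_mono: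
  fixes a b :: "'a::cstar_algebra"
  assumes a: "nonneg a" and b: "nonneg b"
  shows "norm a \<le> norm (a + b)"
proof (cases "a = 0")
  case False
  define c where "c = norm (a + b)"
  define M where "M = norm b + c"
  have M: "norm b / 2 \<le> M" "c / 2 \<le> M" by (simp_all add: M_def c_def)
  have "norm ((M - c / 2) *\<^sub>R x + a * x) \<le> (M + c / 2) * norm x" for x
  proof -
    have "(M - c / 2) *\<^sub>R x + a * x = (M *\<^sub>R x - b * x) - ((c / 2) *\<^sub>R x - (a + b) * x)"
      by (simp add: algebra_simps)
    also have "norm \<dots> \<le> M * norm x + c / 2 * norm x"
      by (intro order_trans[OF norm_triangle_ineq4] add_mono nonneg_shift b nonneg_add a M)
        (simp add: c_def)
    finally show ?thesis by (simp add: distrib_right)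
  qed
  then have "norm a + (M - c / 2) \<le> M + c / 2"
    using M by (intro norm_nonneg_shift_ge[OF a False]) auto
  then show ?thesis by (simp add: c_def)
qed simp

lemma selfadjoint_cube_eq_0:
  fixes x :: "'a::cstar_algebra"
  assumes x: "star x = x" and "x * x * x = 0"
  shows "x = 0"
proof -
  have "(x * x) * (x * x) = 0" using assms(2) by (simp flip: mult.assoc)
  then have "x * x = 0" using norm_selfadjoint_square[of "x * x"] x by (simp add: star_mult)
  then show ?thesis using norm_selfadjoint_square[OF x] by simp
qed

text \<open>The step from squares of self-adjoint elements to \<open>star y * y\<close>. Positivity
  of \<open>c * star c\<close> and positivity of \<open>q\<close> each bound a polynomial in
  \<open>q\<close>, and the two bounds are compatible only for \<open>q = 0\<close>.\<close>

lemma nonneg_if_star_mult_eq_minus: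
  fixes c q :: "'a::cstar_algebra"
  assumes q: "nonneg q" and c: "star c * c = - q"
  shows "c = 0"
proof -
  \<comment> \<open>Real and imaginary part of \<open>c\<close>;
    \<open>c * star c + star c * c\<close> is twice the sum of their squares.\<close>
  define A where "A = (1/2) *\<^sub>R (c + star c)"
  define B where "B = scaleC (- \<i> / 2) (c - star c)"
  have AB: "star A = A" "star B = B"
    by (simp_all add: A_def B_def star_add star_scaleR star_diff star_scaleC add.commute scaleC_diff_right scaleC_minus_left)
  have "B * B = scaleC ((- \<i> / 2) * (- \<i> / 2)) ((c - star c) * (c - star c))"
    by (simp only: B_def mult_scaleC_left mult_scaleC_right scaleC_scaleC)
  also have "\<dots> = (- 1 / 4) *\<^sub>R ((c - star c) * (c - star c))"
    by (subst scaleC_of_real[symmetric]) simp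
  finally have BB: "B * B = (- 1 / 4) *\<^sub>R ((c - star c) * (c - star c))" .
  \<comment> \<open>Hence \<open>c c*\<close> is nonnegative, although \<open>c* c = - q\<close> has the same nonzero spectrum.\<close>
  have "c * star c + star c * c = (A * A + A * A) + (B * B + B * B)"
    unfolding BB by (simp add: A_def algebra_simps flip: scaleR_add_left)
  then have "c * star c = ((A * A + A * A) + (B * B + B * B)) + q" using c by (simp add: algebra_simps)
  then have pos: "nonneg (c * star c)"
    by (simp only:) (intro nonneg_add nonneg_square AB q)
  define g where "g = (norm c)\<^sup>2"
  have g: "norm (c * star c) = g" by (simp add: norm_mult_star g_def)
  have gq: "norm q = g" using norm_star_mult_self[of c] by (simp add: g_def c)
  \<comment> \<open>Carries the shift estimate for \<open>c * star c\<close> at \<open>g / 2\<close>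
    over to \<open>q\<close>.\<close>
  have "(g / 2) *\<^sub>R q + q * q = - (star c * ((g / 2) *\<^sub>R c - c * star c * c))"
  proof -
    have "star c * ((g / 2) *\<^sub>R c - c * star c * c) = (g / 2) *\<^sub>R (star c * c) - (star c * c) * (star c * c)"
      by (simp add: right_diff_distrib mult.assoc)
    then show ?thesis by (simp add: c)
  qed
  then have "norm ((g / 2) *\<^sub>R q + q * q) \<le> norm c * norm ((g / 2) *\<^sub>R c - c * star c * c)"
    using norm_mult_ineq[of "star c"] by simp
  also have "\<dots> \<le> norm c * (g / 2 * norm c)"
    by (intro mult_left_mono nonneg_shift pos) (simp_all add: g)
  finally have 1: "norm ((g / 2) *\<^sub>R q + q * q) \<le> g * g / 2" by (simp add: g_def power2_eq_square algebra_simps)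
  have 2: "norm (g *\<^sub>R q - q * q) \<le> g * g"
    using nonneg_shift[OF q, of g q] by (simp add: gq g_def)
  \<comment> \<open>The left side has norm \<open>3/2 g^2\<close>, whereas the two terms on the
    right amount to at most \<open>g^2\<close>.\<close>
  have "(3 / 2) *\<^sub>R (q * q) = q * q + (1 / 2) *\<^sub>R (q * q)"
    using scaleR_add_left[of 1 "1 / 2" "q * q"] by simp
  also have "\<dots> = ((g / 2) *\<^sub>R q + q * q) - (1 / 2) *\<^sub>R (g *\<^sub>R q - q * q)"
    by (simp add: algebra_simps)
  finally have "norm ((3 / 2) *\<^sub>R (q * q)) \<le> norm ((g / 2) *\<^sub>R q + q * q) + norm ((1 / 2) *\<^sub>R (g *\<^sub>R q - q * q))"
    by (metis norm_triangle_ineq4)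
  then have "g * g \<le> 0"
    using 1 2 norm_selfadjoint_square[OF nonneg_star[OF q]] by (simp add: gq power2_eq_square)
  then have "g = 0" by (simp add: mult_le_0_iff) (simp add: g_def)
  then show ?thesis by (simp add: g_def)
qed

lemma nonneg_star_mult_self: "nonneg (star y * (y::'a::cstar_algebra))"
proof -
  define h where "h = star y * y"
  have h: "star h = h" by (simp add: h_def star_mult)
  obtain z where z: "star z = z" "z * z = h * h" "\<And>x. x * (h * h) = h * h * x \<Longrightarrow> x * z = z * x" "nonneg z"
    using nonneg_sqrtE[OF nonneg_square[OF h]] by metis
  have hz: "h * z = z * h" by (rule z(3)) (simp add: mult.assoc)
  \<comment> \<open>\<open>z = \<bar>h\<bar>\<close> and \<open>v / 2\<close> is the negative part of \<open>h\<close>, so \<open>(y v)* (y v) = v h v\<close> is nonpositive.\<close>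
  define v where "v = z - h"
  have v: "star v = v" "v * z = z * v" by (simp_all add: v_def star_diff z(1) h hz algebra_simps)
  obtain r where r: "star r = r" "r * r = z" "v * r = r * v"
    using nonneg_sqrtE[OF z(4)] v(2) by metis
  have "h * v = - (z * v)" by (simp add: v_def algebra_simps hz z(2))
  then have "star (y * v) * (y * v) = - (v * z * v)"
    by (simp add: star_mult v(1) mult.assoc) (simp add: h_def flip: mult.assoc)
  also have vzv: "v * z * v = (r * v) * (r * v)"
    unfolding r(2)[symmetric] by (metis r(3) mult.assoc)
  finally have yv: "star (y * v) * (y * v) = - ((r * v) * (r * v))" .
  have "star (r * v) = r * v" by (simp add: star_mult r(1,3) v(1))
  from nonneg_if_star_mult_eq_minus[OF nonneg_square[OF this] yv] have "y * v = 0" .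
  \<comment> \<open>Now \<open>v^2 = (z - h) v = 0\<close>, so \<open>h\<close> equals the
    nonnegative element \<open>z\<close>.\<close>
  then have "h * v = 0" by (simp add: h_def mult.assoc)
  then have "z * v = 0" using \<open>h * v = - (z * v)\<close> by simp
  then have "v * v = 0" using \<open>h * v = 0\<close> by (simp add: v_def algebra_simps)
  then have "v = 0" using norm_selfadjoint_square[OF v(1)] by simp
  then show ?thesis using z(4) by (simp add: v_def h_def)
qed

section \<open>Sums, compressions and uniqueness of square roots\<close>

lemma nonneg_sum:
  fixes a :: "'i \<Rightarrow> 'a::cstar_algebra"
  shows "(\<And>i. i \<in> I \<Longrightarrow> nonneg (a i)) \<Longrightarrow> nonneg (\<Sum>i\<in>I. a i)"
  by (induction I rule: infinite_finite_induct)
    (use nonneg_star_mult_self[of "0::'a"] in \<open>auto intro: nonneg_add\<close>)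

lemma norm_le_norm_sum_star_mult:
  fixes x :: "'i \<Rightarrow> 'a::cstar_algebra"
  assumes "finite I" "i \<in> I"
  shows "(norm (x i))\<^sup>2 \<le> norm (\<Sum>j\<in>I. star (x j) * x j)"
proof -
  have "norm (star (x i) * x i) \<le> norm (star (x i) * x i + (\<Sum>j\<in>I - {i}. star (x j) * x j))"
    by (intro nonneg_norm_mono nonneg_sum nonneg_star_mult_self)
  then show ?thesis using assms by (simp add: norm_star_mult_self sum.remove[OF assms])
qed

lemma nonneg_conj: "nonneg a \<Longrightarrow> nonneg (star y * a * (y::'a::cstar_algebra))"
proof -
  assume "nonneg a"
  then obtain w where w: "star w = w" "w * w = a" using nonneg_sqrtE by metis
  then have "star y * a * y = star (w * y) * (w * y)" by (simp add: star_mult mult.assoc flip: w(2))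
  then show ?thesis by (simp only: nonneg_star_mult_self)
qed

text \<open>With \<open>d = p - q\<close>, the nonnegative elements \<open>d p d\<close> and
  \<open>d q d\<close> have sum \<open>d (p + q) d = 0\<close>, so both vanish, and their difference
  is \<open>d^3\<close>.\<close>

lemma nonneg_sqrt_unique:
  fixes p q :: "'a::cstar_algebra"
  assumes p: "nonneg p" and q: "nonneg q" and sq: "p * p = q * q" and comm: "p * q = q * p"
  shows "p = q"
proof -
  define d where "d = p - q"
  have d: "star d = d" by (simp add: d_def star_diff nonneg_star p q)
  have "d * p + d * q = 0" by (simp add: d_def algebra_simps sq comm)
  then have sum: "d * p * d + d * q * d = 0" by (metis distrib_right mult_zero_left)
  have pos: "nonneg (d * p * d)" "nonneg (d * q * d)"
    using nonneg_conj[OF p, of d] nonneg_conj[OF q, of d] d by simp_all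
  have "d * p * d = 0" using nonneg_norm_mono[OF pos] by (simp add: sum)
  moreover have "d * q * d = 0" using sum calculation by simp
  moreover have "d * d * d = d * p * d - d * q * d" by (simp add: d_def algebra_simps)
  ultimately have "d * d * d = 0" by simp
  then have "d = 0" by (rule selfadjoint_cube_eq_0[OF d])
  then show ?thesis by (simp add: d_def)
qed

text \<open>For fixed \<open>k\<close> this is a polynomial in \<open>a\<close>, and all iterates
  have norm at most 2. The constant may grow with \<open>k\<close>, because the tail is estimated
  uniformly in \<open>a\<close>.\<close>

lemma sqrt_iter_lipschitz:
  "\<exists>C\<ge>0. \<forall>a b :: 'a::cstar_algebra. (\<forall>x. norm (x - a * x) \<le> norm x) \<longrightarrow> (\<forall>x. norm (x - b * x) \<le> norm x) \<longrightarrow>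
     norm (sqrt_iter k a - sqrt_iter k b) \<le> C * norm (a - b)"
proof (induction k)
  case (Suc k)
  then obtain C where C: "0 \<le> C" "\<And>a b :: 'a. (\<forall>x. norm (x - a * x) \<le> norm x) \<Longrightarrow>
      (\<forall>x. norm (x - b * x) \<le> norm x) \<Longrightarrow> norm (sqrt_iter k a - sqrt_iter k b) \<le> C * norm (a - b)"
    by blast
  \<comment> \<open>Each of the three terms containing \<open>u - v\<close> contributes
    \<open>2 C\<close>.\<close>
  have "norm (sqrt_iter (Suc k) a - sqrt_iter (Suc k) b) \<le> (1 + 6 * C) * norm (a - b)"
    if a: "\<forall>x. norm (x - a * x) \<le> norm x" and b: "\<forall>x. norm (x - b * x) \<le> norm x" for a b :: 'a
  proof -
    define u v where "u = sqrt_iter k a" and "v = sqrt_iter k b"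
    have n: "norm u \<le> 2" "norm v \<le> 2" "norm (u - v) \<le> C * norm (a - b)"
      unfolding u_def v_def using sqrt_iter_approx(3) C(2) a b by blast+
    have "norm (u * (u - v)) \<le> 2 * (C * norm (a - b))"
      by (rule order_trans[OF norm_mult_ineq mult_mono]) (use n in auto)
    moreover have "norm ((u - v) * v) \<le> (C * norm (a - b)) * 2"
      by (rule order_trans[OF norm_mult_ineq mult_mono]) (use n C(1) in auto)
    moreover have "norm ((2 * sqrt_one k) *\<^sub>R (u - v)) \<le> 2 * (C * norm (a - b))"
      using n(3) sqrt_one_bounds[of k] mult_mono[of "sqrt_one k" 1 "norm (u - v)" "C * norm (a - b)"] by simp
    moreover have "2 *\<^sub>R (sqrt_iter (Suc k) a - sqrt_iter (Suc k) b) =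
        (a - b) + (2 * sqrt_one k) *\<^sub>R (u - v) - (u * (u - v) + (u - v) * v)"
      by (simp add: u_def[symmetric] v_def[symmetric] algebra_simps)
    then have "2 * norm (sqrt_iter (Suc k) a - sqrt_iter (Suc k) b) =
        norm ((a - b) + (2 * sqrt_one k) *\<^sub>R (u - v) - (u * (u - v) + (u - v) * v))"
      by (metis abs_numeral norm_scaleR)
    moreover have "\<dots> \<le> norm (a - b) + norm ((2 * sqrt_one k) *\<^sub>R (u - v)) +
        (norm (u * (u - v)) + norm ((u - v) * v))"
      by (intro order_trans[OF norm_triangle_ineq4] add_mono norm_triangle_ineq)
    ultimately have "2 * norm (sqrt_iter (Suc k) a - sqrt_iter (Suc k) b) \<le>
        norm (a - b) + 6 * (C * norm (a - b))" by linarith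
    moreover have "0 \<le> norm (a - b)" "0 \<le> C * norm (a - b)" using C(1) by simp_all
    ultimately show ?thesis unfolding distrib_right by linarith
  qed
  then show ?case using C(1) by (intro exI[of _ "1 + 6 * C"]) simp
qed auto

text \<open>First \<open>k\<close> is chosen to make both tails small for all \<open>n\<close> at
  once, then the Lipschitz bound for that \<open>k\<close> is used.\<close>

lemma tendsto_cstar_sqrt_diff:
  fixes a b :: "nat \<Rightarrow> 'a::cstar_algebra"
  assumes a: "\<And>n x. norm (x - a n * x) \<le> norm x" and b: "\<And>n x. norm (x - b n * x) \<le> norm x"
    and lim: "(\<lambda>n. a n - b n) \<longlonglongrightarrow> 0"
  shows "(\<lambda>n. cstar_sqrt (a n) - cstar_sqrt (b n)) \<longlonglongrightarrow> 0"
proof (rule tendstoI)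
  fix e :: real assume e: "0 < e"
  have "\<forall>\<^sub>F k in sequentially. dist (sqrt_one k) 1 < e / 8"
    using sqrt_one_tendsto e by (intro tendstoD) auto
  then obtain k where "dist (sqrt_one k) 1 < e / 8" by (meson eventually_happens' trivial_limit_sequentially)
  then have k: "2 * (1 - sqrt_one k) < e / 4" using sqrt_one_bounds(2)[of k] by (simp add: dist_real_def)
  obtain C where C: "0 \<le> C" "\<And>n. norm (sqrt_iter k (a n) - sqrt_iter k (b n)) \<le> C * norm (a n - b n)"
    using sqrt_iter_lipschitz[where 'a = 'a, of k] a b by meson
  have "(\<lambda>n. C * norm (a n - b n)) \<longlonglongrightarrow> 0" by (intro tendsto_mult_right_zero tendsto_norm_zero lim)
  then have "\<forall>\<^sub>F n in sequentially. dist (C * norm (a n - b n)) 0 < e / 4"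
    using e by (intro tendstoD) auto
  then show "\<forall>\<^sub>F n in sequentially. dist (cstar_sqrt (a n) - cstar_sqrt (b n)) 0 < e"
  proof eventually_elim
    case (elim n)
    have "cstar_sqrt (a n) - cstar_sqrt (b n) = (cstar_sqrt (a n) - sqrt_iter k (a n)) +
        (sqrt_iter k (a n) - sqrt_iter k (b n)) - (cstar_sqrt (b n) - sqrt_iter k (b n))"
      by simp
    also have "norm \<dots> \<le> 2 * (1 - sqrt_one k) + C * norm (a n - b n) + 2 * (1 - sqrt_one k)"
      by (intro order_trans[OF norm_triangle_ineq4] order_trans[OF norm_triangle_ineq] add_mono
          sqrt_iter_approx(2) a b C)
    finally show ?case using elim k C(1) e by (simp add: abs_mult)
  qed
qed

lemma positive_iff_nonneg: "positive a \<longleftrightarrow> nonneg (a::'a::cstar_algebra)"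
  using nonneg_star_mult_self nonneg_sqrtE unfolding positive_def by metis

section \<open>Lifting orthogonal positive elements of the sequence algebra\<close>

lemma apply_Bcontfun_bounded:
  fixes f :: "nat \<Rightarrow> 'a::real_normed_vector"
  shows "(\<And>n. norm (f n) \<le> K) \<Longrightarrow> apply_bcontfun (Bcontfun f) = f"
  by (intro Bcontfun_inverse bcontfun_normI) auto

lemma abs_seq_alg_eq_iff:
  "abs_seq_alg f = abs_seq_alg g \<longleftrightarrow> (\<lambda>n. apply_bcontfun f n - apply_bcontfun g n) \<longlonglongrightarrow> 0"
  by (simp add: seq_alg.abs_eq_iff c0_def)

lemma abs_seq_alg_eq_0_iff: "abs_seq_alg f = 0 \<longleftrightarrow> apply_bcontfun f \<longlonglongrightarrow> 0"
  using abs_seq_alg_eq_iff[of f 0] by (simp add: zero_seq_alg.abs_eq)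

lemma abs_seq_alg_cases: obtains f where "x = abs_seq_alg f"
  by (metis Quotient3_abs_rep[OF Quotient3_seq_alg])

lemmas abs_seq_alg_hom =
  plus_seq_alg.abs_eq[symmetric] minus_seq_alg.abs_eq[symmetric] uminus_seq_alg.abs_eq[symmetric]
  times_seq_alg.abs_eq[symmetric] star_seq_alg.abs_eq[symmetric] const_seq.abs_eq[symmetric]

lemma abs_seq_alg_sum: "abs_seq_alg (\<Sum>i\<in>I. f i) = (\<Sum>i\<in>I. abs_seq_alg (f i))"
  by (induction I rule: infinite_finite_induct)
    (simp_all add: abs_seq_alg_hom zero_seq_alg.abs_eq)

lemma abs_seq_alg_scaleR:
  assumes "abs_seq_alg f = abs_seq_alg g"
  shows "abs_seq_alg (c *\<^sub>R f) = abs_seq_alg (c *\<^sub>R g)"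
proof -
  have "(\<lambda>n. c *\<^sub>R (apply_bcontfun f n - apply_bcontfun g n)) \<longlonglongrightarrow> c *\<^sub>R 0"
    using assms unfolding abs_seq_alg_eq_iff by (intro tendsto_intros)
  then show ?thesis by (simp add: abs_seq_alg_eq_iff scaleR_diff_right)
qed

lemma apply_sum_bcontfun: "apply_bcontfun (\<Sum>i\<in>I. f i) n = (\<Sum>i\<in>I. apply_bcontfun (f i) n)"
  by (induction I rule: infinite_finite_induct) simp_all

text \<open>Positivity is used termwise on representatives: each square is dominated in norm by the
  sum, which tends to 0.\<close>

lemma seq_alg_sum_star_mult_eq_0:
  assumes "finite I" "i \<in> I" and sum: "(\<Sum>j\<in>I. star (x j) * x j) = (0::'a::cstar_algebra seq_alg)"
  shows "x i = 0"
proof -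
  have "\<forall>j. \<exists>f. x j = abs_seq_alg f" by (metis abs_seq_alg_cases)
  then obtain f where f: "\<And>j. x j = abs_seq_alg (f j)" by metis
  have "abs_seq_alg (\<Sum>j\<in>I. star (f j) * f j) = 0"
    using sum by (simp add: f abs_seq_alg_sum abs_seq_alg_hom)
  then have "(\<lambda>n. \<Sum>j\<in>I. star (f j n) * f j n) \<longlonglongrightarrow> 0"
    by (simp add: abs_seq_alg_eq_0_iff apply_sum_bcontfun[abs_def])
  then have "(\<lambda>n. (norm (f i n))\<^sup>2) \<longlonglongrightarrow> 0"
    by (rule Lim_null_comparison[OF _ tendsto_norm_zero, rotated])
      (use norm_le_norm_sum_star_mult[OF assms(1,2), of "\<lambda>j. f j n" for n] in simp)
  then have "(\<lambda>n. sqrt ((norm (f i n))\<^sup>2)) \<longlonglongrightarrow> sqrt 0" by (rule tendsto_real_sqrt)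
  then show ?thesis by (simp add: f abs_seq_alg_eq_0_iff tendsto_norm_zero_iff)
qed

text \<open>\<open>P n\<close> is the exact absolute value of \<open>H n\<close>. Since
  \<open>Q n\<close> is the root of its own square, continuity of the root turns agreement of the
  squares in the quotient into agreement of \<open>P\<close> and \<open>Q\<close>.\<close>

lemma asymptotic_absolute_value:
  fixes H Q :: "nat \<Rightarrow>\<^sub>C 'a::cstar_algebra"
  assumes H: "\<And>n. star (H n) = H n" and Q: "\<And>n. nonneg (Q n)"
    and HQ: "abs_seq_alg H * abs_seq_alg H = abs_seq_alg Q * abs_seq_alg Q"
  obtains P :: "nat \<Rightarrow>\<^sub>C 'a" where "\<And>n. nonneg (P n)" "\<And>n. P n * P n = H n * H n"
    "\<And>n. P n * H n = H n * P n" "abs_seq_alg P = abs_seq_alg Q"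
proof -
  \<comment> \<open>One scale for the roots of both sequences; the summand 1 makes it
    positive.\<close>
  define C where "C = norm H + norm Q + 1"
  have C: "0 < C" "norm (H n) \<le> C" "norm (Q n) \<le> C" for n
    using norm_bounded[of H n] norm_bounded[of Q n] norm_ge_zero[of H] norm_ge_zero[of Q]
    unfolding C_def by linarith+
  have shift: "norm (C\<^sup>2 *\<^sub>R x - a * a * x) \<le> C\<^sup>2 * norm x" if "star a = a" "norm a \<le> C" for a x :: 'a
  proof (intro nonneg_shift nonneg_square that)
    have "(norm a)\<^sup>2 \<le> C\<^sup>2" using that by (intro power_mono) auto
    then show "norm (a * a) / 2 \<le> C\<^sup>2"
      using norm_selfadjoint_square[OF that(1)] zero_le_power2[of C] by linarith
  qed
  note sH = shift[OF H C(2)] and sQ = shift[OF nonneg_star[OF Q] C(3)]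
  define a b where "a n = (1 / C\<^sup>2) *\<^sub>R (H n * H n)" and "b n = (1 / C\<^sup>2) *\<^sub>R (Q n * Q n)" for n
  have sHH: "star (H n * H n) = H n * H n" and sQQ: "star (Q n * Q n) = Q n * Q n" for n
    by (simp_all add: star_mult H nonneg_star Q)
  note wH = scaled_sqrt[OF sHH C(1) sH] and wQ = scaled_sqrt[OF sQQ C(1) sQ]
  define P where "P = Bcontfun (\<lambda>n. C *\<^sub>R cstar_sqrt (a n))"
  have P: "apply_bcontfun P = (\<lambda>n. C *\<^sub>R cstar_sqrt (a n))"
    unfolding P_def a_def by (rule apply_Bcontfun_bounded) (rule wH(5))
  have Q_eq: "Q n = C *\<^sub>R cstar_sqrt (b n)" for n
    unfolding b_def
    by (rule nonneg_sqrt_unique[OF Q wQ(4)]) (simp_all only: wQ(2) wQ(3) mult.assoc)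
  have shifted: "norm (x - a n * x) \<le> norm x" "norm (x - b n * x) \<le> norm x" for n x
    unfolding a_def b_def by (rule unit_shift_scaled; use C(1) sH sQ in simp)+
  have "(\<lambda>n. (1 / C\<^sup>2) *\<^sub>R (H n * H n - Q n * Q n)) \<longlonglongrightarrow> (1 / C\<^sup>2) *\<^sub>R 0"
    using HQ by (intro tendsto_intros) (simp add: abs_seq_alg_eq_iff times_seq_alg.abs_eq)
  then have "(\<lambda>n. a n - b n) \<longlonglongrightarrow> 0" by (simp add: a_def b_def scaleR_diff_right)
  then have "(\<lambda>n. cstar_sqrt (a n) - cstar_sqrt (b n)) \<longlonglongrightarrow> 0"
    by (rule tendsto_cstar_sqrt_diff[OF shifted])
  then have "(\<lambda>n. C *\<^sub>R (cstar_sqrt (a n) - cstar_sqrt (b n))) \<longlonglongrightarrow> C *\<^sub>R 0" by (intro tendsto_intros)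
  then have "abs_seq_alg P = abs_seq_alg Q"
    by (simp add: abs_seq_alg_eq_iff P Q_eq scaleR_diff_right)
  moreover have "P n * H n = H n * P n" for n
    unfolding P a_def by (rule wH(3)[symmetric]) (simp only: mult.assoc)
  ultimately show thesis
    by (intro that[of P]) (simp_all only: P a_def wH(2,4))
qed

section \<open>Iterated cubes and exactly orthogonal lifts\<close>

definition cube :: "'a::semigroup_mult \<Rightarrow> 'a"
  where "cube x = x * x * x"

lemma funpow_cube_mult_eq_0:
  fixes x :: "'a::ring"
  shows "y * x = 0 \<Longrightarrow> y * (cube ^^ k) x = 0" "x * y = 0 \<Longrightarrow> (cube ^^ k) x * y = 0"
  by (induction k) (simp_all add: cube_def mult.assoc, simp flip: mult.assoc)

lemma nonneg_funpow_cube: "nonneg a \<Longrightarrow> nonneg ((cube ^^ k) (a::'a::cstar_algebra))"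
proof (induction k)
  case (Suc k)
  then show ?case
    using nonneg_conj[of "(cube ^^ k) a" "(cube ^^ k) a"]
    by (simp add: cube_def[of "(cube ^^ k) a"] nonneg_star)
qed simp

lemma apply_funpow_cube:
  fixes f :: "nat \<Rightarrow>\<^sub>C 'a::cstar_algebra"
  shows "apply_bcontfun ((cube ^^ k) f) n = (cube ^^ k) (apply_bcontfun f n)"
  by (induction k) (simp_all add: cube_def)

lemma abs_seq_alg_funpow_cube: "abs_seq_alg ((cube ^^ k) f) = (cube ^^ k) (abs_seq_alg f)"
  by (induction k) (simp_all add: cube_def abs_seq_alg_hom)

text \<open>The last clause lets orthogonality to the element split off pass through the induction.\<close>

lemma orthogonal_lift:
  fixes X :: "'i \<Rightarrow> nat \<Rightarrow>\<^sub>C 'a::cstar_algebra"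
  assumes "finite I" and "\<And>i n. i \<in> I \<Longrightarrow> nonneg (X i n)"
    and "\<And>i j. i \<in> I \<Longrightarrow> j \<in> I \<Longrightarrow> i \<noteq> j \<Longrightarrow> abs_seq_alg (X i) * abs_seq_alg (X j) = 0"
  shows "\<exists>R :: 'i \<Rightarrow> nat \<Rightarrow>\<^sub>C 'a. (\<forall>i\<in>I. \<forall>n. nonneg (apply_bcontfun (R i) n)) \<and>
    (\<forall>i\<in>I. \<forall>j\<in>I. i \<noteq> j \<longrightarrow> (\<forall>n. apply_bcontfun (R i) n * apply_bcontfun (R j) n = 0)) \<and>
    (\<forall>i\<in>I. abs_seq_alg (R i) = (cube ^^ card I) (abs_seq_alg (X i))) \<and>
    (\<forall>n y. (\<forall>i\<in>I. y * X i n = 0) \<longrightarrow> (\<forall>i\<in>I. y * apply_bcontfun (R i) n = 0))"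
  using assms
proof (induction I arbitrary: X rule: finite_induct)
  case empty
  then show ?case by simp
next
  case (insert i I)
  note X = insert.prems(1) and orth = insert.prems(2)
  let ?x = "\<lambda>j. abs_seq_alg (X j)"
  define S where "S = (\<Sum>j\<in>I. X j)"
  have absS: "abs_seq_alg S = (\<Sum>j\<in>I. ?x j)" by (simp add: S_def abs_seq_alg_sum)
  have Sn: "S n = (\<Sum>j\<in>I. X j n)" for n by (simp add: S_def apply_sum_bcontfun)
  have nonnegS: "nonneg (S n)" for n using X by (auto simp: Sn intro: nonneg_sum)
  have iS: "?x i * abs_seq_alg S = 0" "abs_seq_alg S * ?x i = 0"
    using orth insert.hyps(2) by (auto simp: absS sum_distrib_left sum_distrib_right intro!: sum.neutral)
  \<comment> \<open>\<open>X i\<close> and \<open>S\<close> are orthogonal in the quotient, so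
    \<open>H\<close> and \<open>Q\<close> have the same square there, and the absolute value of
    \<open>H\<close> is asymptotically \<open>Q\<close>.\<close>
  define H Q where "H = X i - S" and "Q = X i + S"
  have H: "star (H n) = H n" for n
    using X nonnegS by (simp add: H_def star_diff nonneg_star)
  have Q: "nonneg (Q n)" for n using X nonnegS by (simp add: Q_def nonneg_add)
  have HQ: "abs_seq_alg H * abs_seq_alg H = abs_seq_alg Q * abs_seq_alg Q"
    by (simp add: H_def Q_def abs_seq_alg_hom algebra_simps iS)
  obtain P :: "nat \<Rightarrow>\<^sub>C 'a" where P: "\<And>n. nonneg (P n)" "\<And>n. P n * P n = H n * H n"
      "\<And>n. P n * H n = H n * P n" "abs_seq_alg P = abs_seq_alg Q"
    by (rule asymptotic_absolute_value[OF H Q HQ]) blast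
  \<comment> \<open>Positive and negative part of \<open>H\<close>: exactly orthogonal, and
    asymptotically \<open>X i\<close> and \<open>S\<close>.\<close>
  define U D where "U = (1/2) *\<^sub>R (P + H)" and "D = (1/2) *\<^sub>R (P - H)"
  have "abs_seq_alg U = abs_seq_alg ((1/2) *\<^sub>R (Q + H))" "abs_seq_alg D = abs_seq_alg ((1/2) *\<^sub>R (Q - H))"
    unfolding U_def D_def by (rule abs_seq_alg_scaleR; simp add: abs_seq_alg_hom P(4))+
  moreover have "(1/2) *\<^sub>R (Q + H) = X i" "(1/2) *\<^sub>R (Q - H) = S"
    by (rule bcontfun_eqI; simp add: Q_def H_def flip: scaleR_2)+
  ultimately have abs_UD: "abs_seq_alg U = ?x i" "abs_seq_alg D = abs_seq_alg S" by simp_all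
  have UD: "U n * D n = 0" for n by (simp add: U_def D_def algebra_simps P)
  have starUD: "star (U n) = U n" "star (D n) = D n" for n
    by (simp_all add: U_def D_def star_scaleR star_add star_diff nonneg_star P H)
  \<comment> \<open>\<open>U^2 = U P\<close>, so the cube of \<open>U\<close> is a compression of
    \<open>P\<close> and inherits nonnegativity.\<close>
  have "cube (U n) = star (U n) * P n * U n" for n
  proof -
    have "U n * U n = U n * P n"
      by (simp add: U_def algebra_simps P(2,3) flip: scaleR_add_left)
    then show ?thesis by (simp add: cube_def starUD)
  qed
  then have nonnegU: "nonneg (cube (U n))" for n using nonneg_conj[OF P(1)] by simp
  define X' where "X' j = D * X j * D" for j
  have X': "nonneg (X' j n)" if "j \<in> I" for j n
    using nonneg_conj[OF X, of j "D n" n] that by (simp add: X'_def starUD)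
  have abs_X': "abs_seq_alg (X' j) = cube (?x j)" if j: "j \<in> I" for j
  proof -
    have "(\<Sum>k\<in>I. ?x k * ?x j) = (\<Sum>k\<in>I. if k = j then ?x j * ?x j else 0)"
      "(\<Sum>k\<in>I. ?x j * ?x k) = (\<Sum>k\<in>I. if k = j then ?x j * ?x j else 0)"
      using orth j by (auto intro!: sum.cong)
    then have "abs_seq_alg S * ?x j = ?x j * ?x j" "?x j * abs_seq_alg S = ?x j * ?x j"
      using j insert.hyps(1) by (simp_all add: absS sum_distrib_left sum_distrib_right)
    then show ?thesis
      by (simp add: X'_def abs_seq_alg_hom abs_UD cube_def) (simp add: mult.assoc)
  qed
  have orth': "abs_seq_alg (X' j) * abs_seq_alg (X' k) = 0" if "j \<in> I" "k \<in> I" "j \<noteq> k" for j k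
  proof -
    have "?x j * (?x k * y) = 0" for y using orth that by (simp flip: mult.assoc)
    then show ?thesis by (simp add: abs_X' that cube_def mult.assoc)
  qed
  obtain R :: "'i \<Rightarrow> nat \<Rightarrow>\<^sub>C 'a" where lift: "\<forall>j\<in>I. \<forall>n. nonneg (apply_bcontfun (R j) n)"
      "\<forall>j\<in>I. \<forall>k\<in>I. j \<noteq> k \<longrightarrow> (\<forall>n. apply_bcontfun (R j) n * apply_bcontfun (R k) n = 0)"
      "\<forall>j\<in>I. abs_seq_alg (R j) = (cube ^^ card I) (abs_seq_alg (X' j))"
      "\<forall>n y. (\<forall>j\<in>I. y * X' j n = 0) \<longrightarrow> (\<forall>j\<in>I. y * apply_bcontfun (R j) n = 0)"
    by (rule exE[OF insert.IH[of X']], blast intro: X', blast intro: orth', elim conjE) (rule that)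
  note R = lift[rule_format]
  \<comment> \<open>The exponent matches that of the other elements, which undergo the compression
    by \<open>D\<close> and then \<open>card I\<close> cubes.\<close>
  define V where "V = (cube ^^ Suc (card I)) U"
  have Vn: "V n = (cube ^^ card I) (cube (U n))" for n
    by (simp only: V_def apply_funpow_cube funpow_Suc_right comp_apply) (simp add: cube_def)
  have V: "nonneg (V n)" for n unfolding Vn by (rule nonneg_funpow_cube[OF nonnegU])
  \<comment> \<open>\<open>V n\<close> annihilates \<open>D n\<close>, hence every
    \<open>X' k n\<close>, and the last clause of the induction hypothesis passes this on to
    \<open>R j n\<close>.\<close>
  have VR: "V n * R j n = 0" if "j \<in> I" for j n
  proof (rule R(4)[OF _ that])
    fix k assume "k \<in> I"
    have "V n * D n = 0"
      unfolding V_def apply_funpow_cube by (rule funpow_cube_mult_eq_0(2)[OF UD])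
    then show "V n * X' k n = 0" by (simp add: X'_def flip: mult.assoc)
  qed
  have RV: "R j n * V n = 0" if "j \<in> I" for j n
    using arg_cong[OF VR[OF that, of n], of star] that by (simp add: star_mult nonneg_star V R(1))
  \<comment> \<open>Restores that clause for the larger index set: \<open>y\<close> annihilates
    \<open>H n\<close>, hence \<open>P n\<close> because \<open>P^2 = H^2\<close>, hence
    \<open>U n\<close> and \<open>D n\<close>.\<close>
  have ann: "y * V n = 0 \<and> (\<forall>j\<in>I. y * R j n = 0)" if y: "\<forall>j\<in>insert i I. y * X j n = 0" for y n
  proof -
    have yS: "y * S n = 0" using y by (simp add: Sn sum_distrib_left)
    then have yH: "y * H n = 0" using y by (simp add: H_def right_diff_distrib)
    have "(y * P n) * star (y * P n) = y * (P n * P n) * star y"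
      by (simp add: star_mult nonneg_star[OF P(1)] mult.assoc)
    also have "\<dots> = 0" using yH by (simp add: P(2) flip: mult.assoc)
    finally have yP: "y * P n = 0" using norm_mult_star[of "y * P n"] by simp
    have yUD: "y * U n = 0" "y * D n = 0"
      using yH yP by (simp_all add: U_def D_def distrib_left right_diff_distrib)
    have "y * V n = 0" unfolding V_def apply_funpow_cube by (rule funpow_cube_mult_eq_0(1)[OF yUD(1)])
    moreover have "\<forall>j\<in>I. y * X' j n = 0" using yUD(2) by (simp add: X'_def flip: mult.assoc)
    ultimately show ?thesis using R(4) by blast
  qed
  have absV: "abs_seq_alg V = (cube ^^ Suc (card I)) (?x i)"
    by (simp only: V_def abs_seq_alg_funpow_cube abs_UD)
  have absR: "abs_seq_alg (R j) = (cube ^^ Suc (card I)) (?x j)" if "j \<in> I" for j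
    using that by (simp only: R(3) abs_X' funpow_Suc_right comp_apply)
  show ?case
    using insert.hyps V VR RV R(1,2) absV absR ann
    by (intro exI[of _ "R(i := V)"]) (auto simp del: funpow.simps)
qed

section \<open>The central sequence algebra and approximate units\<close>

lemma const_seq_diff: "const_seq (a - b) = const_seq a - const_seq (b::'a::cstar_algebra)"
proof -
  have "const_bcontfun (a - b) = const_bcontfun a - (const_bcontfun b :: nat \<Rightarrow>\<^sub>C 'a)"
    by (rule bcontfun_eqI) simp
  then show ?thesis by (simp only: const_seq.abs_eq minus_seq_alg.abs_eq)
qed

lemma const_seq_funpow_cube: "const_seq ((cube ^^ k) a) = (cube ^^ k) (const_seq (a::'a::cstar_algebra))"
  by (induction k) (simp_all add: cube_def const_seq_simps)

lemma central_rel_refl: "x \<in> rel_commutant \<Longrightarrow> central_rel x x"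
  by (simp add: central_rel_def annihilator_closed)

lemma abs_central_alg_eq_iff:
  assumes "x \<in> rel_commutant" "y \<in> rel_commutant"
  shows "abs_central_alg x = abs_central_alg y \<longleftrightarrow> (\<forall>a. x * const_seq a = y * const_seq a)"
proof -
  have "abs_central_alg x = abs_central_alg y \<longleftrightarrow> central_rel x y"
    using Quotient3_rel[OF Quotient3_central_alg, of x y] assms by (simp add: central_rel_refl)
  then show ?thesis
    using assms by (simp add: central_rel_def annihilator_def rel_commutant_closed left_diff_distrib)
qed

lemma abs_central_alg_cases:
  obtains x where "x \<in> rel_commutant" "z = abs_central_alg x"
proof
  show "rep_central_alg z \<in> rel_commutant"
    using Quotient3_rep_reflp[OF Quotient3_central_alg, of z] by (simp add: central_rel_def)
  show "z = abs_central_alg (rep_central_alg z)"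
    by (simp add: Quotient3_abs_rep[OF Quotient3_central_alg])
qed

lemma abs_central_alg_hom:
  assumes "x \<in> rel_commutant"
  shows "star (abs_central_alg x) = abs_central_alg (star x)"
    and "y \<in> rel_commutant \<Longrightarrow> abs_central_alg x * abs_central_alg y = abs_central_alg (x * y)"
    and "y \<in> rel_commutant \<Longrightarrow> abs_central_alg x + abs_central_alg y = abs_central_alg (x + y)"
  using assms
  by (simp_all add: central_rel_refl star_central_alg.abs_eq times_central_alg.abs_eq plus_central_alg.abs_eq)

lemma abs_central_alg_sum:
  assumes "finite I" "\<And>i. i \<in> I \<Longrightarrow> x i \<in> rel_commutant"
  shows "(\<Sum>i\<in>I. x i) \<in> rel_commutant"
    and "(\<Sum>i\<in>I. abs_central_alg (x i)) = abs_central_alg (\<Sum>i\<in>I. x i)"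
  using assms
  by (induction I rule: finite_induct)
    (simp_all add: rel_commutant_closed zero_central_alg.abs_eq[symmetric] abs_central_alg_hom)

text \<open>Positivity is left out so that the notion is stable under products, and with it under
  \<open>cube\<close>.\<close>

definition approx_unit :: "(nat \<Rightarrow> 'a::cstar_algebra) \<Rightarrow> bool"
  where "approx_unit u \<longleftrightarrow> (\<forall>n. norm (u n) \<le> 1) \<and>
    (\<forall>a. (\<lambda>n. u n * a) \<longlonglongrightarrow> a \<and> (\<lambda>n. a * u n) \<longlonglongrightarrow> a)"

lemma approx_unit_mult:
  assumes u: "approx_unit u" and v: "approx_unit v"
  shows "approx_unit (\<lambda>n. u n * v n)"
proof -
  have n: "norm (u n) \<le> 1" "norm (v n) \<le> 1" for n
    using u v by (simp_all add: approx_unit_def)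
  have "norm (u n * v n) \<le> 1" for n
    using norm_mult_ineq[of "u n" "v n"] mult_mono[OF n(1) n(2)] by (simp add: order_trans)
  moreover have "(\<lambda>n. u n * v n * a) \<longlonglongrightarrow> a" for a
  proof -
    have "(\<lambda>n. norm (v n * a - a)) \<longlonglongrightarrow> 0"
      using v by (intro tendsto_norm_zero LIM_zero) (simp add: approx_unit_def)
    then have "(\<lambda>n. u n * (v n * a - a)) \<longlonglongrightarrow> 0"
      by (rule Lim_null_comparison[rotated])
        (intro always_eventually allI order_trans[OF norm_mult_ineq] mult_left_le_one_le n norm_ge_zero)
    moreover have "(\<lambda>n. u n * a) \<longlonglongrightarrow> a" using u by (simp add: approx_unit_def)
    ultimately have "(\<lambda>n. u n * (v n * a - a) + u n * a) \<longlonglongrightarrow> 0 + a" by (rule tendsto_add)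
    then show ?thesis by (simp add: right_diff_distrib mult.assoc)
  qed
  moreover have "(\<lambda>n. a * (u n * v n)) \<longlonglongrightarrow> a" for a
  proof -
    have "(\<lambda>n. norm (a * u n - a)) \<longlonglongrightarrow> 0"
      using u by (intro tendsto_norm_zero LIM_zero) (simp add: approx_unit_def)
    then have "(\<lambda>n. (a * u n - a) * v n) \<longlonglongrightarrow> 0"
      by (rule Lim_null_comparison[rotated])
        (intro always_eventually allI order_trans[OF norm_mult_ineq] mult_right_le_one_le n norm_ge_zero)
    moreover have "(\<lambda>n. a * v n) \<longlonglongrightarrow> a" using v by (simp add: approx_unit_def)
    ultimately have "(\<lambda>n. (a * u n - a) * v n + a * v n) \<longlonglongrightarrow> 0 + a" by (rule tendsto_add)
    then show ?thesis by (simp add: left_diff_distrib mult.assoc)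
  qed
  ultimately show ?thesis by (simp add: approx_unit_def)
qed

lemma approx_unit_funpow_cube: "approx_unit u \<Longrightarrow> approx_unit (\<lambda>n. (cube ^^ k) (u n))"
  by (induction k) (simp_all add: cube_def approx_unit_mult)

lemma star_hom_funpow_cube: "star_hom \<phi> \<Longrightarrow> \<phi> ((cube ^^ k) a) = (cube ^^ k) (\<phi> a)"
  by (induction k) (simp_all add: cube_def star_hom_def)

lemma star_hom_sum: "star_hom \<phi> \<Longrightarrow> \<phi> (\<Sum>i\<in>I. f i) = (\<Sum>i\<in>I. \<phi> (f i))"
  by (induction I rule: infinite_finite_induct) (simp_all add: star_hom_0, simp add: star_hom_def)

lemma action_star_hom:
  assumes "\<alpha> \<in> hom G (Aut :: ('a::cstar_algebra \<Rightarrow> 'a) monoid)"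
  shows "g \<in> carrier G \<Longrightarrow> \<alpha> g \<in> carrier Aut" "g \<in> carrier G \<Longrightarrow> star_hom (\<alpha> g)"
    "g \<in> carrier G \<Longrightarrow> h \<in> carrier G \<Longrightarrow> \<alpha> g (\<alpha> h a) = \<alpha> (g \<otimes>\<^bsub>G\<^esub> h) a"
    "g \<in> carrier G \<Longrightarrow> \<exists>b. \<alpha> g b = a"
proof -
  show *: "\<alpha> g \<in> carrier Aut" if "g \<in> carrier G" for g using assms that by (auto simp: hom_def)
  show "star_hom (\<alpha> g)" if "g \<in> carrier G" for g using *[OF that] by (simp add: Aut_def)
  show "g \<in> carrier G \<Longrightarrow> \<exists>b. \<alpha> g b = a" using *[of g] by (auto simp: Aut_def bij_def surj_def) metis
  assume "g \<in> carrier G" "h \<in> carrier G"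
  then have "\<alpha> (g \<otimes>\<^bsub>G\<^esub> h) = \<alpha> g \<otimes>\<^bsub>Aut\<^esub> \<alpha> h" using assms by (auto simp: hom_def)
  then show "\<alpha> g (\<alpha> h a) = \<alpha> (g \<otimes>\<^bsub>G\<^esub> h) a" by (simp add: Aut_def)
qed

lemma approx_unit_image:
  assumes u: "approx_unit u" and \<phi>: "star_hom \<phi>" "surj \<phi>"
  shows "approx_unit (\<lambda>n. \<phi> (u n))"
proof -
  have cont: "(\<lambda>n. \<phi> (y n)) \<longlonglongrightarrow> \<phi> a" if "y \<longlonglongrightarrow> a" for y a
  proof (rule LIM_zero_cancel, rule Lim_null_comparison)
    show "(\<lambda>n. norm (y n - a)) \<longlonglongrightarrow> 0" using that by (intro tendsto_norm_zero LIM_zero)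
    show "\<forall>\<^sub>F n in sequentially. norm (\<phi> (y n) - \<phi> a) \<le> norm (y n - a)"
      by (simp add: star_hom_norm_le[OF \<phi>(1)] flip: star_hom_diff[OF \<phi>(1)])
  qed
  have mult: "\<phi> a * \<phi> b = \<phi> (a * b)" for a b using \<phi>(1) by (simp add: star_hom_def)
  have "(\<lambda>n. \<phi> (u n) * a) \<longlonglongrightarrow> a \<and> (\<lambda>n. a * \<phi> (u n)) \<longlonglongrightarrow> a" for a
  proof -
    obtain b where "a = \<phi> b" using \<phi>(2) by (metis surjD)
    then show ?thesis using u by (simp add: mult cont approx_unit_def)
  qed
  then show ?thesis
    using u star_hom_norm_le[OF \<phi>(1)] by (auto simp: approx_unit_def intro: order_trans)
qed

text \<open>Average over the orbit of \<open>e\<close>: left translation by \<open>h\<close>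
  permutes the summands, and self-adjointness is inherited from positivity of
  \<open>e\<close>.\<close>

lemma invariant_approx_unit:
  fixes \<alpha> :: "'g \<Rightarrow> 'a::cstar_algebra \<Rightarrow> 'a"
  assumes "sigma_unital TYPE('a)" and "group G" and fin: "finite (carrier G)" and \<alpha>: "\<alpha> \<in> hom G Aut"
  obtains u :: "nat \<Rightarrow> 'a" where "approx_unit u" "\<And>n. star (u n) = u n"
    "\<And>n g. g \<in> carrier G \<Longrightarrow> \<alpha> g (u n) = u n"
proof -
  interpret group G by fact
  note \<alpha>_hom = action_star_hom[OF \<alpha>]
  obtain e :: "nat \<Rightarrow> 'a" where e: "\<And>n. positive (e n)" "approx_unit e"
    using assms(1) unfolding sigma_unital_def approx_unit_def by blast
  define N where "N = real (card (carrier G))"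
  have N: "0 < N" using fin by (auto simp: N_def card_gt_0_iff)
  define u where "u n = (1 / N) *\<^sub>R (\<Sum>g\<in>carrier G. \<alpha> g (e n))" for n
  have "approx_unit (\<lambda>n. \<alpha> g (e n))" if "g \<in> carrier G" for g
    using \<alpha>_hom(1)[OF that] by (intro approx_unit_image[OF e(2) \<alpha>_hom(2)[OF that]]) (simp add: Aut_def bij_is_surj)
  then have \<alpha>e: "norm (\<alpha> g (e n)) \<le> 1" "(\<lambda>n. \<alpha> g (e n) * a) \<longlonglongrightarrow> a" "(\<lambda>n. a * \<alpha> g (e n)) \<longlonglongrightarrow> a"
    if "g \<in> carrier G" for g n a
    using that unfolding approx_unit_def by blast+
  have "norm (u n) \<le> 1" for n
  proof -
    have "norm (\<Sum>g\<in>carrier G. \<alpha> g (e n)) \<le> (\<Sum>g\<in>carrier G. 1)"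
      by (rule sum_norm_le) (rule \<alpha>e(1))
    then show ?thesis using N by (simp add: u_def N_def)
  qed
  moreover have "(\<lambda>n. u n * a) \<longlonglongrightarrow> a" "(\<lambda>n. a * u n) \<longlonglongrightarrow> a" for a
  proof -
    have "(\<lambda>n. (1 / N) *\<^sub>R (\<Sum>g\<in>carrier G. \<alpha> g (e n) * a)) \<longlonglongrightarrow> (1 / N) *\<^sub>R (\<Sum>g\<in>carrier G. a)"
      "(\<lambda>n. (1 / N) *\<^sub>R (\<Sum>g\<in>carrier G. a * \<alpha> g (e n))) \<longlonglongrightarrow> (1 / N) *\<^sub>R (\<Sum>g\<in>carrier G. a)"
      by (intro tendsto_scaleR tendsto_const tendsto_sum \<alpha>e(2,3); assumption)+
    moreover have "(1 / N) *\<^sub>R (\<Sum>g\<in>carrier G. a) = a"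
      using N by (simp add: N_def sum_constant_scaleR)
    ultimately show "(\<lambda>n. u n * a) \<longlonglongrightarrow> a" "(\<lambda>n. a * u n) \<longlonglongrightarrow> a"
      by (simp_all add: u_def sum_distrib_left sum_distrib_right)
  qed
  ultimately have "approx_unit u" by (simp add: approx_unit_def)
  moreover have "star (u n) = u n" for n
  proof -
    have "star (\<alpha> g (e n)) = \<alpha> g (e n)" if "g \<in> carrier G" for g
      using \<alpha>_hom(2)[OF that] e(1)[of n] by (metis positive_iff_nonneg nonneg_star star_hom_def)
    moreover have "star (\<Sum>g\<in>I. f g) = (\<Sum>g\<in>I. star (f g))" for I and f :: "'g \<Rightarrow> 'a"
      by (induction I rule: infinite_finite_induct) (simp_all add: star_add)
    ultimately show ?thesis by (simp add: u_def star_scaleR)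
  qed
  moreover have "\<alpha> h (u n) = u n" if h: "h \<in> carrier G" for h n
  proof -
    have "\<alpha> h (u n) = (1 / N) *\<^sub>R (\<Sum>g\<in>carrier G. \<alpha> (h \<otimes>\<^bsub>G\<^esub> g) (e n))"
      using h by (simp add: u_def star_hom_scaleR star_hom_sum \<alpha>_hom(2,3))
    also have "(\<Sum>g\<in>carrier G. \<alpha> (h \<otimes>\<^bsub>G\<^esub> g) (e n)) = (\<Sum>g\<in>carrier G. \<alpha> g (e n))"
      by (rule sum.reindex_bij_witness[where i = "\<lambda>g. inv\<^bsub>G\<^esub> h \<otimes>\<^bsub>G\<^esub> g" and j = "\<lambda>g. h \<otimes>\<^bsub>G\<^esub> g"])
        (use h in \<open>auto simp flip: m_assoc\<close>)
    finally show ?thesis by (simp add: u_def)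
  qed
  ultimately show thesis by (rule that)
qed

section \<open>From the central sequence Rokhlin property to the Rokhlin property\<close>

text \<open>The class of an approximate unit; it represents the unit of \<open>F(A)\<close>.\<close>

lemma approx_unit_seq_alg:
  fixes u :: "nat \<Rightarrow> 'a::cstar_algebra"
  assumes u: "approx_unit u"
  obtains E :: "'a seq_alg" where "E \<in> rel_commutant" "\<And>a. E * const_seq a = const_seq a" "\<And>a. const_seq a * E = const_seq a"
proof -
  have U: "apply_bcontfun (Bcontfun u) = u"
    by (rule apply_Bcontfun_bounded[of _ 1]) (use u in \<open>simp add: approx_unit_def\<close>)
  define E where "E = abs_seq_alg (Bcontfun u)"
  have "E * const_seq a = const_seq a" "const_seq a * E = const_seq a" for a
    using u LIM_zero[of "\<lambda>n. u n * a" a] LIM_zero[of "\<lambda>n. a * u n" a]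
    by (simp_all add: E_def const_seq.abs_eq times_seq_alg.abs_eq abs_seq_alg_eq_iff U approx_unit_def)
  then show thesis by (intro that[of E]) (simp_all add: rel_commutant_def)
qed

text \<open>Relations in \<open>F(A)\<close> become relations in the sequence algebra multiplied by
  constants. A representative \<open>f\<close> of \<open>p\<close> may be replaced by
  \<open>star f * f\<close>, since \<open>star p * p = p\<close>; this makes all terms
  nonnegative.\<close>

lemma central_projections_lift:
  fixes G :: "('g, 'm) monoid_scheme" and \<alpha> :: "'g \<Rightarrow> 'a::cstar_algebra \<Rightarrow> 'a"
  assumes su: "sigma_unital TYPE('a)" and "group G" and fin: "finite (carrier G)" and \<alpha>: "\<alpha> \<in> hom G Aut"
    and csr: "central_sequence_rokhlin G \<alpha>"
  obtains F :: "'g \<Rightarrow> nat \<Rightarrow>\<^sub>C 'a" where "\<And>g n. nonneg (F g n)"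
    "\<And>g a. abs_seq_alg (F g) * const_seq a = const_seq a * abs_seq_alg (F g)"
    "\<And>g a. g \<in> carrier G \<Longrightarrow> abs_seq_alg (F g) * (abs_seq_alg (F g) * const_seq a) = abs_seq_alg (F g) * const_seq a"
    "\<And>g h a. g \<in> carrier G \<Longrightarrow> h \<in> carrier G \<Longrightarrow> g \<noteq> h \<Longrightarrow> abs_seq_alg (F g) * (abs_seq_alg (F h) * const_seq a) = 0"
    "\<And>a. (\<Sum>g\<in>carrier G. abs_seq_alg (F g)) * const_seq a = const_seq a"
    "\<And>g h a. g \<in> carrier G \<Longrightarrow> h \<in> carrier G \<Longrightarrow>
      seq_map (\<alpha> g) (abs_seq_alg (F h)) * const_seq a = abs_seq_alg (F (g \<otimes>\<^bsub>G\<^esub> h)) * const_seq a"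
proof -
  interpret group G by fact
  obtain p :: "'g \<Rightarrow> 'a central_alg" where p: "\<And>g. g \<in> carrier G \<Longrightarrow> projection (p g)"
      "(\<Sum>g\<in>carrier G. p g) = central_one"
      "\<And>g h. g \<in> carrier G \<Longrightarrow> h \<in> carrier G \<Longrightarrow> central_map (\<alpha> g) (p h) = p (g \<otimes>\<^bsub>G\<^esub> h)"
    using csr unfolding central_sequence_rokhlin_def by blast
  have "\<forall>g. \<exists>f. abs_seq_alg f \<in> rel_commutant \<and> p g = abs_central_alg (abs_seq_alg f)"
    by (metis abs_central_alg_cases abs_seq_alg_cases)
  then obtain f where f: "\<And>g. abs_seq_alg (f g) \<in> rel_commutant"
      "\<And>g. p g = abs_central_alg (abs_seq_alg (f g))" by metis
  define F where "F g = star (f g) * f g" for g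
  define x where "x g = abs_seq_alg (F g)" for g
  have x: "x g = star (abs_seq_alg (f g)) * abs_seq_alg (f g)" for g
    by (simp add: x_def F_def abs_seq_alg_hom)
  have x_rc: "x g \<in> rel_commutant" for g
    unfolding x by (intro rel_commutant_closed f)
  then have comm: "x g * const_seq a = const_seq a * x g" for g a by (simp add: rel_commutant_def)
  have px: "p g = abs_central_alg (x g)" if "g \<in> carrier G" for g
  proof -
    have "p g = star (p g) * p g" using p(1)[OF that] by (simp add: projection_def)
    then show ?thesis by (simp add: f x abs_central_alg_hom rel_commutant_closed)
  qed
  have idem: "x g * (x g * const_seq a) = x g * const_seq a" if "g \<in> carrier G" for g a
  proof -
    have "p g * p g = p g" using p(1)[OF that] by (simp add: projection_def)
    then have "abs_central_alg (x g * x g) = abs_central_alg (x g)"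
      by (simp add: px[OF that] abs_central_alg_hom x_rc)
    then show ?thesis by (simp add: abs_central_alg_eq_iff x_rc rel_commutant_closed mult.assoc)
  qed
  have sum: "(\<Sum>g\<in>carrier G. x g) * const_seq a = const_seq a" for a
  proof -
    obtain u :: "nat \<Rightarrow> 'a" where "approx_unit u" using invariant_approx_unit[OF assms(1-4)] .
    then obtain E :: "'a seq_alg" where E: "E \<in> rel_commutant" "\<And>a. E * const_seq a = const_seq a"
      by (rule approx_unit_seq_alg) blast
    \<comment> \<open>\<open>central_one\<close> comes without a representative, so its unit
      property is applied to the class of \<open>E\<close>.\<close>
    have "abs_central_alg (\<Sum>g\<in>carrier G. x g) = central_one"
      unfolding p(2)[symmetric] by (simp add: px abs_central_alg_sum fin x_rc)
    then have "abs_central_alg (\<Sum>g\<in>carrier G. x g) * abs_central_alg E = abs_central_alg E"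
      using is_unit_elt_central_one[OF su] by (simp add: is_unit_elt_def)
    then have "(\<Sum>g\<in>carrier G. x g) * E * const_seq a = E * const_seq a"
      by (simp add: abs_central_alg_hom abs_central_alg_eq_iff abs_central_alg_sum fin x_rc E(1) rel_commutant_closed)
    then show ?thesis by (simp add: mult.assoc E)
  qed
  have equivariant: "seq_map (\<alpha> g) (x h) * const_seq a = x (g \<otimes>\<^bsub>G\<^esub> h) * const_seq a"
    if gh: "g \<in> carrier G" "h \<in> carrier G" for g h a
  proof -
    note \<phi> = action_star_hom(1)[OF \<alpha> gh(1)]
    have "abs_central_alg (seq_map (\<alpha> g) (x h)) = abs_central_alg (x (g \<otimes>\<^bsub>G\<^esub> h))"
      using p(3)[OF gh] gh by (simp add: px central_map_abs[OF \<phi>] x_rc)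
    then show ?thesis
      by (simp add: abs_central_alg_eq_iff seq_map_rel_commutant[OF \<phi>] x_rc)
  qed
  \<comment> \<open>On constants, the terms \<open>x_i x_j\<close> with \<open>i\<close> other than
    \<open>j\<close> add up to \<open>x_j - x_j^2 = 0\<close>. Multiplied on the left by
    \<open>star (x_j a)\<close>, they become elements \<open>star y * y\<close> by idempotence, so
    each vanishes.\<close>
  have orth: "x i * (x j * const_seq a) = 0" if ij: "i \<in> carrier G" "j \<in> carrier G" "i \<noteq> j" for i j a
  proof (rule seq_alg_sum_star_mult_eq_0[of "carrier G - {j}" i "\<lambda>i. x i * (x j * const_seq a)"])
    let ?c = "const_seq a"
    have star_x: "star (x g) = x g" for g by (simp add: x star_mult)
    have sq: "star (x i * (x j * ?c)) * (x i * (x j * ?c)) = star (x j * ?c) * (x i * (x j * ?c))"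
      if "i \<in> carrier G" for i
    proof -
      have "x i * (x i * (x j * ?c)) = x i * (x i * ?c) * x j" by (simp add: comm[of j] mult.assoc)
      also have "\<dots> = x i * (x j * ?c)" by (simp add: idem[OF that] comm[of j] mult.assoc)
      finally show ?thesis by (simp add: star_mult star_x mult.assoc)
    qed
    have "(\<Sum>i\<in>carrier G. x i * (x j * ?c)) = (\<Sum>i\<in>carrier G. x i) * ?c * x j"
      by (simp add: comm[of j] sum_distrib_right mult.assoc)
    also have "\<dots> = x j * (x j * ?c)" by (metis sum comm idem[OF ij(2)])
    finally have "(\<Sum>i\<in>carrier G - {j}. x i * (x j * ?c)) = 0"
      using fin ij(2) by (simp add: sum.remove[of _ j])
    then show "(\<Sum>i\<in>carrier G - {j}. star (x i * (x j * ?c)) * (x i * (x j * ?c))) = 0"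
      by (simp add: sq flip: sum_distrib_left)
  qed (use ij fin in auto)
  show thesis
  proof (rule that[of F])
    show "nonneg (F g n)" for g n by (simp add: F_def nonneg_star_mult_self)
  qed (use comm idem orth sum equivariant in \<open>simp_all add: x_def\<close>)
qed

lemma rokhlin_if_central_sequence_rokhlin:
  fixes G :: "('g, 'm) monoid_scheme" and \<alpha> :: "'g \<Rightarrow> 'a::cstar_algebra \<Rightarrow> 'a"
  assumes su: "sigma_unital TYPE('a)" and G: "group G" and fin: "finite (carrier G)" and \<alpha>: "\<alpha> \<in> hom G Aut"
    and csr: "central_sequence_rokhlin G \<alpha>"
  shows "rokhlin G \<alpha>"
  unfolding rokhlin_def
proof (intro allI impI)
  fix \<epsilon> :: real and S :: "'a set"
  assume \<epsilon>: "0 < \<epsilon>" and S: "finite S"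
  interpret group G by fact
  note \<alpha>_hom = action_star_hom[OF \<alpha>]
  obtain F :: "'g \<Rightarrow> nat \<Rightarrow>\<^sub>C 'a" where F: "\<And>g n. nonneg (F g n)"
    and comm: "\<And>g a. abs_seq_alg (F g) * const_seq a = const_seq a * abs_seq_alg (F g)"
    and idem: "\<And>g a. g \<in> carrier G \<Longrightarrow> abs_seq_alg (F g) * (abs_seq_alg (F g) * const_seq a) = abs_seq_alg (F g) * const_seq a"
    and orth: "\<And>g h a. g \<in> carrier G \<Longrightarrow> h \<in> carrier G \<Longrightarrow> g \<noteq> h \<Longrightarrow> abs_seq_alg (F g) * (abs_seq_alg (F h) * const_seq a) = 0"
    and sum: "\<And>a. (\<Sum>g\<in>carrier G. abs_seq_alg (F g)) * const_seq a = const_seq a"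
    and equivariant: "\<And>g h a. g \<in> carrier G \<Longrightarrow> h \<in> carrier G \<Longrightarrow>
      seq_map (\<alpha> g) (abs_seq_alg (F h)) * const_seq a = abs_seq_alg (F (g \<otimes>\<^bsub>G\<^esub> h)) * const_seq a"
    by (rule central_projections_lift[OF assms]) blast
  let ?x = "\<lambda>g. abs_seq_alg (F g)"
  have left_comm: "const_seq a * (?x g * y) = ?x g * (const_seq a * y)" for a g y
    by (metis comm mult.assoc)
  obtain u :: "nat \<Rightarrow> 'a" where u: "approx_unit u" "\<And>n. star (u n) = u n"
      "\<And>n g. g \<in> carrier G \<Longrightarrow> \<alpha> g (u n) = u n"
    by (rule invariant_approx_unit[OF assms(1-4)]) blast
  let ?N = "card (carrier G)"
  \<comment> \<open>\<open>K\<close> bounds every \<open>F g n\<close>, so commutators below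
    \<open>\<epsilon> / K\<close> stay below \<open>\<epsilon>\<close> after multiplication by
    \<open>F g n\<close>.\<close>
  define K where "K = 1 + (\<Sum>g\<in>carrier G. norm (F g))"
  have K: "1 \<le> K" "g \<in> carrier G \<Longrightarrow> norm (F g n) \<le> K" for g n
  proof -
    show "1 \<le> K" by (simp add: K_def sum_nonneg)
    assume "g \<in> carrier G"
    then have "norm (F g) \<le> (\<Sum>g\<in>carrier G. norm (F g))" using fin by (intro member_le_sum) auto
    then show "norm (F g n) \<le> K" using norm_bounded[of "F g" n] by (simp add: K_def)
  qed
  \<comment> \<open>Orthogonalizing the compressions by \<open>u n\<close> will replace the factor
    \<open>u n * u n\<close> by its \<open>?N\<close>-fold cube, so \<open>v\<close> is the
    approximate unit to be controlled.\<close>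
  define v where "v n = (cube ^^ ?N) (u n * u n)" for n
  have v: "approx_unit v"
    unfolding v_def by (intro approx_unit_funpow_cube approx_unit_mult u(1))
  have "\<forall>\<^sub>F n in sequentially. \<forall>a\<in>S. norm (v n * a - a) < \<epsilon> \<and> norm (v n * a - a * v n) < \<epsilon> / K"
  proof (intro eventually_ball_finite S ballI eventually_conj)
    fix a
    have lim: "(\<lambda>n. v n * a) \<longlonglongrightarrow> a" "(\<lambda>n. a * v n) \<longlonglongrightarrow> a" using v by (simp_all add: approx_unit_def)
    show "\<forall>\<^sub>F n in sequentially. norm (v n * a - a) < \<epsilon>"
      using tendstoD[OF lim(1) \<epsilon>] by (simp add: dist_norm)
    have "(\<lambda>n. v n * a - a * v n) \<longlonglongrightarrow> a - a" by (intro tendsto_diff lim)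
    then show "\<forall>\<^sub>F n in sequentially. norm (v n * a - a * v n) < \<epsilon> / K"
      using \<epsilon> K(1) by (auto dest: tendstoD[where e = "\<epsilon> / K"])
  qed
  \<comment> \<open>Two limits are taken in turn: the index \<open>m\<close> of the approximate unit
    is fixed here, and the index of the representing sequences tends to infinity later.\<close>
  then obtain m where m: "\<And>a. a \<in> S \<Longrightarrow> norm (v m * a - a) < \<epsilon>"
      "\<And>a. a \<in> S \<Longrightarrow> norm (v m * a - a * v m) < \<epsilon> / K"
    using eventually_happens'[OF sequentially_bot] by blast
  define e c where "e = u m" and "c = v m"
  have c_norm: "norm c \<le> 1" using v by (simp add: c_def approx_unit_def)
  have c_inv: "\<alpha> g c = c" if "g \<in> carrier G" for g
    using \<alpha>_hom(2)[OF that] u(3)[OF that]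
    by (simp add: c_def v_def star_hom_funpow_cube) (simp add: star_hom_def)
  have c_cube: "const_seq c = (cube ^^ ?N) (const_seq (e * e))"
    by (simp add: c_def v_def e_def const_seq_funpow_cube)

  \<comment> \<open>Compressions and their orthogonalization\<close>
  define X where "X g = const_bcontfun e * F g * const_bcontfun e" for g
  \<comment> \<open>Compressing from both sides keeps the terms nonnegative; centrality collects the
    two factors \<open>e\<close> on one side.\<close>
  have abs_X: "abs_seq_alg (X g) = ?x g * const_seq (e * e)" for g
    by (simp add: X_def abs_seq_alg_hom const_seq_simps flip: comm mult.assoc)
  have X: "nonneg (X g n)" for g n
    using nonneg_conj[OF F, of e g n] by (simp add: X_def u(2) e_def)
  have X_orth: "abs_seq_alg (X g) * abs_seq_alg (X h) = 0"
    if "g \<in> carrier G" "h \<in> carrier G" "g \<noteq> h" for g h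
  proof -
    have "abs_seq_alg (X g) * abs_seq_alg (X h) = ?x g * (?x h * const_seq (e * e)) * const_seq (e * e)"
      by (simp only: abs_X left_comm comm[symmetric] mult.assoc)
    then show ?thesis by (simp add: orth that)
  qed
  obtain R :: "'g \<Rightarrow> nat \<Rightarrow>\<^sub>C 'a" where lift: "\<forall>g\<in>carrier G. \<forall>n. nonneg (apply_bcontfun (R g) n)"
      "\<forall>g\<in>carrier G. \<forall>h\<in>carrier G. g \<noteq> h \<longrightarrow> (\<forall>n. apply_bcontfun (R g) n * apply_bcontfun (R h) n = 0)"
      "\<forall>g\<in>carrier G. abs_seq_alg (R g) = (cube ^^ ?N) (abs_seq_alg (X g))"
    by (rule exE[OF orthogonal_lift[of "carrier G" X]], rule fin, rule X, blast intro: X_orth, elim conjE)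
      (rule that)
  note R = lift[rule_format]
  have abs_R: "abs_seq_alg (R g) = ?x g * const_seq c" if g: "g \<in> carrier G" for g
  proof -
    have "(cube ^^ k) (?x g * const_seq d) = ?x g * const_seq ((cube ^^ k) d)" for k d
    proof (induction k)
      case (Suc k)
      let ?d = "const_seq ((cube ^^ k) d)"
      \<comment> \<open>\<open>?x g\<close> commutes with constants and is idempotent on them, so
        only the constant factor is cubed.\<close>
      have "cube (?x g * ?d) = ?x g * (?x g * (?x g * ?d)) * (?d * ?d)"
        by (simp only: cube_def left_comm comm[symmetric] mult.assoc)
      also have "\<dots> = ?x g * const_seq (cube ((cube ^^ k) d))"
        by (simp add: idem[OF g] cube_def const_seq_simps mult.assoc)
      finally show ?case by (simp add: Suc)
    qed simp
    then show ?thesis by (simp add: R(3) g abs_X c_def v_def e_def)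
  qed

  \<comment> \<open>Rescaling to contractions\<close>
  define Y where "Y g n = (1 / max 1 (norm (R g n))) *\<^sub>R R g n" for g n
  \<comment> \<open>The rescaling does not change the class: \<open>\<parallel>b\<parallel>\<^sup>2 \<approx> \<parallel>c* F c\<parallel> \<le> \<parallel>b\<parallel>\<close> for \<open>b = F c\<close>, as \<open>F\<^sup>2 c \<approx> F c\<close>.\<close>
  have Y_norm: "norm (Y g n) \<le> 1" for g n by (simp add: Y_def)
  define r where "r g = Bcontfun (Y g)" for g
  have r: "apply_bcontfun (r g) = Y g" for g
    unfolding r_def by (rule apply_Bcontfun_bounded[of _ 1]) (rule Y_norm)
  have Y_nonneg: "nonneg (Y g n)" if "g \<in> carrier G" for g n
  proof -
    define s where "s = sqrt (1 / max 1 (norm (R g n)))"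
    have "nonneg (R g n)" using R(1) that .
    then obtain w where w: "star w = w" "w * w = R g n" using nonneg_sqrtE by metis
    have "s * s = 1 / max 1 (norm (R g n))" by (simp add: s_def)
    then have "Y g n = (s *\<^sub>R w) * (s *\<^sub>R w)" by (simp add: Y_def w)
    then show ?thesis using nonneg_square[of "s *\<^sub>R w"] by (simp add: star_scaleR w)
  qed
  have Y_orth: "Y g n * Y h n = 0" if "g \<in> carrier G" "h \<in> carrier G" "g \<noteq> h" for g h n
    using R(2)[OF that] by (simp add: Y_def)
  have abs_r: "abs_seq_alg (r g) = ?x g * const_seq c" if g: "g \<in> carrier G" for g
  proof -
    define b where "b n = F g n * c" for n
    define \<eta> where "\<eta> n = norm (star (b n) * b n - star c * b n)" for n
    have "star (?x g) = ?x g"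
    proof -
      have "star (F g) = F g" by (rule bcontfun_eqI) (simp add: nonneg_star F)
      then show ?thesis by (simp add: star_seq_alg.abs_eq)
    qed
    then have "abs_seq_alg (star (F g * const_bcontfun c) * (F g * const_bcontfun c)) =
        abs_seq_alg (star (const_bcontfun c) * (F g * const_bcontfun c))"
      by (simp add: abs_seq_alg_hom star_mult mult.assoc idem[OF g])
    then have \<eta>_lim: "\<eta> \<longlonglongrightarrow> 0"
      unfolding abs_seq_alg_eq_iff \<eta>_def by (intro tendsto_norm_zero) (simp add: b_def)
    have R_lim: "(\<lambda>n. R g n - b n) \<longlonglongrightarrow> 0"
      using abs_R[OF g] unfolding const_seq.abs_eq times_seq_alg.abs_eq abs_seq_alg_eq_iff by (simp add: b_def)
    have b_le: "norm (b n) \<le> 1 + \<eta> n" for n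
    proof (cases "norm (b n) \<le> 1")
      case True
      moreover have "0 \<le> \<eta> n" by (simp add: \<eta>_def)
      ultimately show ?thesis by simp
    next
      case False
      have "(norm (b n))\<^sup>2 \<le> norm (star c * b n) + \<eta> n"
        using norm_triangle_ineq[of "star c * b n" "star (b n) * b n - star c * b n"]
        by (simp add: \<eta>_def norm_star_mult_self)
      also have "norm (star c * b n) \<le> norm (b n)"
        using norm_mult_ineq[of "star c" "b n"] mult_right_mono[OF c_norm, of "norm (b n)"] by simp
      finally have "norm (b n) * (norm (b n) - 1) \<le> \<eta> n" by (simp add: power2_eq_square algebra_simps)
      moreover have "1 * (norm (b n) - 1) \<le> norm (b n) * (norm (b n) - 1)"
        using False by (intro mult_right_mono) auto
      ultimately show ?thesis by simp
    qed
    have Y_le: "norm (Y g n - R g n) \<le> norm (R g n - b n) + \<eta> n" for n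
    proof (cases "norm (R g n) \<le> 1")
      case True
      then show ?thesis by (simp add: Y_def max_def \<eta>_def)
    next
      case False
      have "Y g n - R g n = (1 / norm (R g n) - 1) *\<^sub>R R g n"
        using False by (simp add: Y_def max_def algebra_simps)
      then have "norm (Y g n - R g n) = \<bar>1 / norm (R g n) - 1\<bar> * norm (R g n)" by simp
      also have "\<bar>1 / norm (R g n) - 1\<bar> = 1 - 1 / norm (R g n)"
        using False by (intro abs_of_nonpos[THEN trans]) (auto simp: divide_le_eq_1)
      also have "(1 - 1 / norm (R g n)) * norm (R g n) = norm (R g n) - 1"
        using False by (auto simp: left_diff_distrib)
      also have "\<dots> \<le> norm (R g n - b n) + \<eta> n"
        using norm_triangle_ineq[of "R g n - b n" "b n"] b_le[of n] by simp
      finally show ?thesis .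
    qed
    have "(\<lambda>n. norm (R g n - b n) + \<eta> n) \<longlonglongrightarrow> 0"
      using tendsto_add[OF tendsto_norm_zero[OF R_lim] \<eta>_lim] by simp
    then have "(\<lambda>n. Y g n - R g n) \<longlonglongrightarrow> 0"
      by (rule Lim_null_comparison[rotated]) (simp add: Y_le)
    then have "abs_seq_alg (r g) = abs_seq_alg (R g)" by (simp add: abs_seq_alg_eq_iff r)
    then show ?thesis by (simp add: abs_R[OF g])
  qed

  \<comment> \<open>The approximate relations\<close>
  have ev1: "\<forall>\<^sub>F n in sequentially. \<forall>g\<in>carrier G. \<forall>h\<in>carrier G. norm (\<alpha> g (Y h n) - Y (g \<otimes>\<^bsub>G\<^esub> h) n) < \<epsilon>"
  proof (intro eventually_ball_finite fin ballI)
    fix g h assume gh: "g \<in> carrier G" "h \<in> carrier G"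
    note \<phi> = \<alpha>_hom(2)[OF gh(1)]
    \<comment> \<open>\<open>c\<close> is fixed by the action, so equivariance of
      \<open>?x h\<close> on constants passes to \<open>?x h * const_seq c\<close>.\<close>
    have "seq_map (\<alpha> g) (abs_seq_alg (r h)) = abs_seq_alg (r (g \<otimes>\<^bsub>G\<^esub> h))"
      using gh by (simp add: abs_r seq_map_hom[OF \<phi>] c_inv equivariant)
    then have "(\<lambda>n. \<alpha> g (Y h n) - Y (g \<otimes>\<^bsub>G\<^esub> h) n) \<longlonglongrightarrow> 0"
      unfolding seq_map_abs[OF \<phi>] abs_seq_alg_eq_iff apply_Bcontfun_star_hom[OF \<phi>] by (simp add: r)
    then show "\<forall>\<^sub>F n in sequentially. norm (\<alpha> g (Y h n) - Y (g \<otimes>\<^bsub>G\<^esub> h) n) < \<epsilon>"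
      using tendstoD[OF _ \<epsilon>] by fastforce
  qed
  have ev2: "\<forall>\<^sub>F n in sequentially. \<forall>a\<in>S. \<forall>g\<in>carrier G. norm (Y g n * a - a * Y g n) < \<epsilon>"
  proof (intro eventually_ball_finite fin S ballI)
    fix a g assume a: "a \<in> S" and g: "g \<in> carrier G"
    \<comment> \<open>\<open>F g\<close> commutes asymptotically with constants, so the commutator
      of \<open>Y g n\<close> with \<open>a\<close> is asymptotically \<open>F g n * d\<close>;
      \<open>norm d < \<epsilon> / K\<close> leaves a margin for the limit.\<close>
    define d where "d = c * a - a * c"
    have "abs_seq_alg (r g) * const_seq a - const_seq a * abs_seq_alg (r g) = ?x g * const_seq d"
      by (simp add: abs_r[OF g] d_def const_seq_diff const_seq_simps right_diff_distrib mult.assoc left_comm)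
    then have "(\<lambda>n. (Y g n * a - a * Y g n) - F g n * d) \<longlonglongrightarrow> 0"
      unfolding const_seq.abs_eq times_seq_alg.abs_eq minus_seq_alg.abs_eq abs_seq_alg_eq_iff by (simp add: r)
    moreover have "norm d < \<epsilon> / K" using m(2)[OF a] by (simp add: d_def c_def)
    then have d: "0 < \<epsilon> - K * norm d" using K(1) by (simp add: field_simps)
    ultimately have "\<forall>\<^sub>F n in sequentially. dist ((Y g n * a - a * Y g n) - F g n * d) 0 < \<epsilon> - K * norm d"
      by (rule tendstoD)
    then show "\<forall>\<^sub>F n in sequentially. norm (Y g n * a - a * Y g n) < \<epsilon>"
    proof eventually_elim
      case (elim n)
      have "norm (F g n * d) \<le> K * norm d"
        by (rule order_trans[OF norm_mult_ineq mult_right_mono[OF K(2)[OF g]]]) simp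
      then show ?case
        using elim norm_triangle_ineq[of "(Y g n * a - a * Y g n) - F g n * d" "F g n * d"] by simp
    qed
  qed
  have ev3: "\<forall>\<^sub>F n in sequentially. \<forall>a\<in>S. norm ((\<Sum>g\<in>carrier G. Y g n) * a - a) < \<epsilon>"
  proof (intro eventually_ball_finite S ballI)
    fix a assume a: "a \<in> S"
    \<comment> \<open>The sum is \<open>c\<close> and not a unit, so a part of
      \<open>\<epsilon>\<close> is spent on \<open>c * a - a\<close>.\<close>
    have "(\<Sum>g\<in>carrier G. abs_seq_alg (r g)) = const_seq c"
      by (simp add: abs_r sum flip: sum_distrib_right)
    then have "abs_seq_alg (\<Sum>g\<in>carrier G. r g) * const_seq a = const_seq (c * a)"
      by (simp add: abs_seq_alg_sum const_seq_simps)
    then have "(\<lambda>n. (\<Sum>g\<in>carrier G. Y g n) * a - c * a) \<longlonglongrightarrow> 0"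
      unfolding const_seq.abs_eq times_seq_alg.abs_eq abs_seq_alg_eq_iff by (simp add: r apply_sum_bcontfun)
    moreover have ca: "0 < \<epsilon> - norm (c * a - a)" using m(1)[OF a] by (simp add: c_def)
    ultimately have "\<forall>\<^sub>F n in sequentially. dist ((\<Sum>g\<in>carrier G. Y g n) * a - c * a) 0 < \<epsilon> - norm (c * a - a)"
      by (rule tendstoD)
    then show "\<forall>\<^sub>F n in sequentially. norm ((\<Sum>g\<in>carrier G. Y g n) * a - a) < \<epsilon>"
    proof eventually_elim
      case (elim n)
      then show ?case
        using norm_triangle_ineq[of "(\<Sum>g\<in>carrier G. Y g n) * a - c * a" "c * a - a"] by simp
    qed
  qed
  obtain n where "\<forall>g\<in>carrier G. \<forall>h\<in>carrier G. norm (\<alpha> g (Y h n) - Y (g \<otimes>\<^bsub>G\<^esub> h) n) < \<epsilon>"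
      "\<forall>a\<in>S. \<forall>g\<in>carrier G. norm (Y g n * a - a * Y g n) < \<epsilon>"
      "\<forall>a\<in>S. norm ((\<Sum>g\<in>carrier G. Y g n) * a - a) < \<epsilon>"
    using eventually_happens'[OF sequentially_bot eventually_conj[OF ev1 eventually_conj[OF ev2 ev3]]] by blast
  then show "\<exists>r. (\<forall>g\<in>carrier G. positive (r g) \<and> norm (r g) \<le> 1) \<and>
      (\<forall>g\<in>carrier G. \<forall>h\<in>carrier G. g \<noteq> h \<longrightarrow> r g * r h = 0) \<and>
      (\<forall>g\<in>carrier G. \<forall>h\<in>carrier G. norm (\<alpha> g (r h) - r (g \<otimes>\<^bsub>G\<^esub> h)) < \<epsilon>) \<and>
      (\<forall>a\<in>S. \<forall>g\<in>carrier G. norm (r g * a - a * r g) < \<epsilon>) \<and>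
      (\<forall>a\<in>S. norm ((\<Sum>g\<in>carrier G. r g) * a - a) < \<epsilon>)"
    using Y_nonneg Y_norm Y_orth positive_iff_nonneg by (intro exI[of _ "\<lambda>g. Y g n"]) blast
qed

section \<open>The converse for separable algebras\<close>

text \<open>Equicontinuity: the common Lipschitz constant \<open>K\<close> makes the error of
  replacing \<open>a\<close> by a nearby \<open>b\<close> in \<open>C\<close> independent of
  \<open>n\<close>.\<close>

lemma tendsto_zero_if_tendsto_zero_dense:
  fixes L :: "nat \<Rightarrow> 'a::real_normed_vector \<Rightarrow> 'b::real_normed_vector"
  assumes C: "closure C = UNIV" and lim: "\<And>b. b \<in> C \<Longrightarrow> (\<lambda>n. L n b) \<longlonglongrightarrow> 0"
    and K: "0 < K" "\<And>n a b. norm (L n a - L n b) \<le> K * norm (a - b)"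
  shows "(\<lambda>n. L n a) \<longlonglongrightarrow> 0"
proof (rule tendstoI)
  fix \<epsilon> :: real assume \<epsilon>: "0 < \<epsilon>"
  have "a \<in> closure C" by (simp add: C)
  then obtain b where b: "b \<in> C" "dist b a < \<epsilon> / 2 / K"
    using \<epsilon> K(1) unfolding closure_approachable by (meson divide_pos_pos half_gt_zero)
  then have ab: "K * norm (a - b) < \<epsilon> / 2"
    using K(1) by (simp add: dist_norm norm_minus_commute field_simps)
  have "\<forall>\<^sub>F n in sequentially. dist (L n b) 0 < \<epsilon> / 2"
    using lim[OF b(1)] \<epsilon> by (intro tendstoD) auto
  then show "\<forall>\<^sub>F n in sequentially. dist (L n a) 0 < \<epsilon>"
  proof eventually_elim
    case (elim n)
    then show ?case using K(2)[of n a b] ab norm_triangle_ineq[of "L n b" "L n a - L n b"] by simp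
  qed
qed

text \<open>Diagonal choice along a dense sequence; the commutation and sum conditions depend on
  \<open>a\<close> in a Lipschitz way, with constants 2 and \<open>card (carrier G) + 1\<close>, and
  so extend to all \<open>a\<close>.\<close>

lemma rokhlin_sequence:
  fixes G :: "('g, 'm) monoid_scheme" and \<alpha> :: "'g \<Rightarrow> 'a::cstar_algebra \<Rightarrow> 'a"
  assumes sep: "separable_space (euclidean :: 'a topology)" and fin: "finite (carrier G)" and rok: "rokhlin G \<alpha>"
  obtains r :: "nat \<Rightarrow> 'g \<Rightarrow> 'a"
  where "\<And>n g. g \<in> carrier G \<Longrightarrow> nonneg (r n g)" "\<And>n g. g \<in> carrier G \<Longrightarrow> norm (r n g) \<le> 1"
    "\<And>n g h. g \<in> carrier G \<Longrightarrow> h \<in> carrier G \<Longrightarrow> g \<noteq> h \<Longrightarrow> r n g * r n h = 0"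
    "\<And>g h. g \<in> carrier G \<Longrightarrow> h \<in> carrier G \<Longrightarrow> (\<lambda>n. \<alpha> g (r n h) - r n (g \<otimes>\<^bsub>G\<^esub> h)) \<longlonglongrightarrow> 0"
    "\<And>g a. g \<in> carrier G \<Longrightarrow> (\<lambda>n. r n g * a - a * r n g) \<longlonglongrightarrow> 0"
    "\<And>a. (\<lambda>n. (\<Sum>g\<in>carrier G. r n g) * a - a) \<longlonglongrightarrow> 0"
proof -
  obtain C :: "'a set" where C: "countable C" "closure C = UNIV"
    using sep by (auto simp: separable_space_def)
  then have "C \<noteq> {}" by auto
  define s where "s = from_nat_into C"
  have range: "C = range s"
    using C(1) \<open>C \<noteq> {}\<close> by (simp add: s_def range_from_nat_into)
  define \<delta> where "\<delta> n = inverse (real (Suc n))" for n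
  have \<delta>: "0 < \<delta> n" "\<delta> \<longlonglongrightarrow> 0" for n
    unfolding \<delta>_def by (simp, rule LIMSEQ_inverse_real_of_nat)
  \<comment> \<open>Each point \<open>s m\<close> is controlled from stage \<open>m\<close>
    on.\<close>
  define good where "good n r \<longleftrightarrow> (\<forall>g\<in>carrier G. positive (r g) \<and> norm (r g) \<le> 1) \<and>
      (\<forall>g\<in>carrier G. \<forall>h\<in>carrier G. g \<noteq> h \<longrightarrow> r g * r h = 0) \<and>
      (\<forall>g\<in>carrier G. \<forall>h\<in>carrier G. norm (\<alpha> g (r h) - r (g \<otimes>\<^bsub>G\<^esub> h)) < \<delta> n) \<and>
      (\<forall>a\<in>s ` {..n}. \<forall>g\<in>carrier G. norm (r g * a - a * r g) < \<delta> n) \<and>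
      (\<forall>a\<in>s ` {..n}. norm ((\<Sum>g\<in>carrier G. r g) * a - a) < \<delta> n)" for n r
  have "\<forall>n. \<exists>r. good n r"
    unfolding good_def by (intro allI rok[unfolded rokhlin_def, rule_format] \<delta>(1)) auto
  then obtain r :: "nat \<Rightarrow> 'g \<Rightarrow> 'a" where good: "good n (r n)" for n by metis
  have r: "positive (r n g)" "norm (r n g) \<le> 1" if "g \<in> carrier G" for n g
    using good[of n] that by (simp_all add: good_def)
  have r2: "g \<noteq> h \<Longrightarrow> r n g * r n h = 0" "norm (\<alpha> g (r n h) - r n (g \<otimes>\<^bsub>G\<^esub> h)) < \<delta> n"
    if "g \<in> carrier G" "h \<in> carrier G" for n g h
    using good[of n] that by (simp_all add: good_def)
  have r_comm: "norm (r n g * a - a * r n g) < \<delta> n" if "a \<in> s ` {..n}" "g \<in> carrier G" for n a g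
    using good[of n] that unfolding good_def by blast
  have r_sum: "norm ((\<Sum>g\<in>carrier G. r n g) * a - a) < \<delta> n" if "a \<in> s ` {..n}" for n a
    using good[of n] that unfolding good_def by blast
  have dense: "(\<lambda>n. L n a) \<longlonglongrightarrow> 0"
    if "0 < K" "\<And>n a b. norm (L n a - L n b) \<le> K * norm (a - b)"
      and L: "\<And>n a. a \<in> s ` {..n} \<Longrightarrow> norm (L n a) < \<delta> n"
    for L :: "nat \<Rightarrow> 'a \<Rightarrow> 'a" and K a
  proof (rule tendsto_zero_if_tendsto_zero_dense[OF C(2) _ that(1,2)])
    fix b assume "b \<in> C"
    then obtain m where "b = s m" by (auto simp: range)
    then have "\<forall>\<^sub>F n in sequentially. norm (L n b) \<le> \<delta> n"
      using L by (intro eventually_sequentiallyI[of m]) (auto intro: less_imp_le)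
    then show "(\<lambda>n. L n b) \<longlonglongrightarrow> 0" using \<delta>(2) by (rule Lim_null_comparison)
  qed
  show thesis
  proof (rule that[of r])
    show "nonneg (r n g)" if "g \<in> carrier G" for n g using r(1)[OF that] by (simp add: positive_iff_nonneg)
    show "(\<lambda>n. \<alpha> g (r n h) - r n (g \<otimes>\<^bsub>G\<^esub> h)) \<longlonglongrightarrow> 0" if "g \<in> carrier G" "h \<in> carrier G" for g h
      using r2(2)[OF that] by (intro Lim_null_comparison[OF _ \<delta>(2)] always_eventually) (simp add: less_imp_le)
    show "(\<lambda>n. r n g * a - a * r n g) \<longlonglongrightarrow> 0" if g: "g \<in> carrier G" for g a
    proof (rule dense[of 2])
      fix n a b
      have "r n g * a - a * r n g - (r n g * b - b * r n g) = r n g * (a - b) - (a - b) * r n g"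
        by (simp add: algebra_simps)
      also have "norm \<dots> \<le> norm (r n g) * norm (a - b) + norm (a - b) * norm (r n g)"
        by (intro order_trans[OF norm_triangle_ineq4] add_mono norm_mult_ineq)
      also have "\<dots> \<le> 2 * norm (a - b)"
        using mult_right_mono[OF r(2)[OF g, of n], of "norm (a - b)"] by (simp add: mult.commute)
      finally show "norm (r n g * a - a * r n g - (r n g * b - b * r n g)) \<le> 2 * norm (a - b)" .
    qed (use r_comm g in auto)
    show "(\<lambda>n. (\<Sum>g\<in>carrier G. r n g) * a - a) \<longlonglongrightarrow> 0" for a
    proof (rule dense[of "real (card (carrier G)) + 1"])
      fix n a b
      let ?S = "\<Sum>g\<in>carrier G. r n g"
      have "norm ?S \<le> (\<Sum>g\<in>carrier G. 1)" by (rule sum_norm_le) (rule r(2))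
      then have S: "norm ?S \<le> real (card (carrier G))" by simp
      have "?S * a - a - (?S * b - b) = ?S * (a - b) - (a - b)" by (simp add: algebra_simps)
      also have "norm \<dots> \<le> norm ?S * norm (a - b) + norm (a - b)"
        by (intro order_trans[OF norm_triangle_ineq4] add_mono norm_mult_ineq order_refl)
      also have "\<dots> \<le> (real (card (carrier G)) + 1) * norm (a - b)"
        using mult_right_mono[OF S, of "norm (a - b)"] by (simp add: distrib_right)
      finally show "norm (?S * a - a - (?S * b - b)) \<le> (real (card (carrier G)) + 1) * norm (a - b)" .
    qed (use r_sum in auto)
  qed (use r r2 in auto)
qed

lemma central_sequence_rokhlin_if_rokhlin:
  fixes G :: "('g, 'm) monoid_scheme" and \<alpha> :: "'g \<Rightarrow> 'a::cstar_algebra \<Rightarrow> 'a"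
  assumes su: "sigma_unital TYPE('a)" and "group G" and fin: "finite (carrier G)" and \<alpha>: "\<alpha> \<in> hom G Aut"
    and sep: "separable_space (euclidean :: 'a topology)" and rok: "rokhlin G \<alpha>"
  shows "central_sequence_rokhlin G \<alpha>"
proof -
  interpret group G by fact
  obtain r :: "nat \<Rightarrow> 'g \<Rightarrow> 'a"
    where r: "\<And>n g. g \<in> carrier G \<Longrightarrow> nonneg (r n g)" "\<And>n g. g \<in> carrier G \<Longrightarrow> norm (r n g) \<le> 1"
      "\<And>n g h. g \<in> carrier G \<Longrightarrow> h \<in> carrier G \<Longrightarrow> g \<noteq> h \<Longrightarrow> r n g * r n h = 0"
      "\<And>g h. g \<in> carrier G \<Longrightarrow> h \<in> carrier G \<Longrightarrow> (\<lambda>n. \<alpha> g (r n h) - r n (g \<otimes>\<^bsub>G\<^esub> h)) \<longlonglongrightarrow> 0"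
      "\<And>g a. g \<in> carrier G \<Longrightarrow> (\<lambda>n. r n g * a - a * r n g) \<longlonglongrightarrow> 0"
      "\<And>a. (\<lambda>n. (\<Sum>g\<in>carrier G. r n g) * a - a) \<longlonglongrightarrow> 0"
    by (rule rokhlin_sequence[OF sep fin rok]) blast
  define f where "f g = Bcontfun (\<lambda>n. r n g)" for g
  have f: "apply_bcontfun (f g) = (\<lambda>n. r n g)" if "g \<in> carrier G" for g
    unfolding f_def by (rule apply_Bcontfun_bounded) (rule r(2)[OF that])
  define x where "x g = abs_seq_alg (f g)" for g
  have x_rc: "x g \<in> rel_commutant" if g: "g \<in> carrier G" for g
    using r(5)[OF g]
    by (simp add: x_def rel_commutant_def const_seq.abs_eq times_seq_alg.abs_eq abs_seq_alg_eq_iff f[OF g])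
  have star_x: "star (x g) = x g" if g: "g \<in> carrier G" for g
  proof -
    have "star (f g) = f g" by (rule bcontfun_eqI) (simp add: f[OF g] nonneg_star r(1)[OF g])
    then show ?thesis by (simp add: x_def star_seq_alg.abs_eq)
  qed
  have orth: "x g * x h = 0" if "g \<in> carrier G" "h \<in> carrier G" "g \<noteq> h" for g h
    using r(3)[OF that] by (simp add: x_def times_seq_alg.abs_eq abs_seq_alg_eq_0_iff f that)
  have sum: "(\<Sum>g\<in>carrier G. x g) * const_seq a = const_seq a" for a
  proof -
    have "apply_bcontfun (\<Sum>g\<in>carrier G. f g) n = (\<Sum>g\<in>carrier G. r n g)" for n
      by (simp add: apply_sum_bcontfun f)
    then have "abs_seq_alg ((\<Sum>g\<in>carrier G. f g) * const_bcontfun a) = abs_seq_alg (const_bcontfun a)"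
      using r(6)[of a] by (simp add: abs_seq_alg_eq_iff)
    then show ?thesis by (simp add: abs_seq_alg_hom abs_seq_alg_sum x_def)
  qed
  \<comment> \<open>Orthogonality leaves only \<open>x_g^2\<close> in the product of
    \<open>x_g\<close> with the sum, and the sum acts on constants as a unit.\<close>
  have idem: "x g * x g * const_seq a = x g * const_seq a" if g: "g \<in> carrier G" for g a
  proof -
    have "x g * (\<Sum>h\<in>carrier G. x h) = (\<Sum>h\<in>carrier G. if h = g then x g * x g else 0)"
      unfolding sum_distrib_left by (rule sum.cong) (use orth g in auto)
    then have "x g * (\<Sum>h\<in>carrier G. x h) = x g * x g" using fin g by simp
    then show ?thesis by (metis mult.assoc sum)
  qed
  have equivariant: "seq_map (\<alpha> g) (x h) = x (g \<otimes>\<^bsub>G\<^esub> h)" if gh: "g \<in> carrier G" "h \<in> carrier G" for g h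
  proof -
    note \<phi> = action_star_hom(2)[OF \<alpha> gh(1)]
    show ?thesis
      unfolding x_def seq_map_abs[OF \<phi>] abs_seq_alg_eq_iff apply_Bcontfun_star_hom[OF \<phi>]
      using r(4)[OF gh] gh by (simp add: f)
  qed
  define p where "p g = abs_central_alg (x g)" for g
  show ?thesis
    unfolding central_sequence_rokhlin_def
  proof (intro exI[of _ p] conjI ballI)
    show "projection (p g)" if g: "g \<in> carrier G" for g
      using x_rc[OF g] idem[OF g]
      by (simp add: projection_def p_def abs_central_alg_hom star_x[OF g] abs_central_alg_eq_iff rel_commutant_closed)
    show "central_map (\<alpha> g) (p h) = p (g \<otimes>\<^bsub>G\<^esub> h)" if "g \<in> carrier G" "h \<in> carrier G" for g h
      using that by (simp add: p_def central_map_abs action_star_hom(1)[OF \<alpha>] x_rc equivariant)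
    let ?s = "\<Sum>g\<in>carrier G. x g"
    have s: "?s \<in> rel_commutant" "(\<Sum>g\<in>carrier G. p g) = abs_central_alg ?s"
      unfolding p_def by (rule abs_central_alg_sum; use fin x_rc in blast)+
    \<comment> \<open>A left unit \<open>s\<close> suffices, since
      \<open>s = s * central_one = central_one\<close>.\<close>
    have "abs_central_alg ?s * z = z" for z
    proof -
      obtain y where y: "y \<in> rel_commutant" "z = abs_central_alg y" by (rule abs_central_alg_cases)
      have "?s * y * const_seq a = y * const_seq a" for a
        using y(1) by (simp add: rel_commutant_def mult.assoc) (simp add: sum flip: mult.assoc)
      then show ?thesis
        by (simp add: y abs_central_alg_hom s(1) abs_central_alg_eq_iff rel_commutant_closed)
    qed
    then show "(\<Sum>g\<in>carrier G. p g) = central_one"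
      using is_unit_elt_central_one[OF su] unfolding s(2) is_unit_elt_def by metis
  qed
qed

theorem corollary2:
  fixes G :: "('g, 'm) monoid_scheme" and \<alpha> :: "'g \<Rightarrow> 'a::cstar_algebra \<Rightarrow> 'a"
  assumes "sigma_unital TYPE('a)"
    and "group G" and "finite (carrier G)"
    and "\<alpha> \<in> hom G Aut"
  shows "(central_sequence_rokhlin G \<alpha> \<longrightarrow> rokhlin G \<alpha>) \<and>
    (separable_space (euclidean :: 'a topology) \<longrightarrow>
      (central_sequence_rokhlin G \<alpha> \<longleftrightarrow> rokhlin G \<alpha>))"
  using rokhlin_if_central_sequence_rokhlin[OF assms] central_sequence_rokhlin_if_rokhlin[OF assms]
  by blast

end
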